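(* Let $u=x_1^{a_1}\cdots x_n^{a_n}$ and $v=x_2^{b_2}\cdots x_n^{b_n}$ be monomials of degree $d\ge 2$ in $S=k[x_1,\ldots,x_n]$, with $a_1>0$. Suppose that the ideal $I=(\mathcal{L}(u,v))$ is not a completely lexsegment ideal. Then $I$ has a linear resolution if and only if $I$ has linear quotients.
   Context: $S=k[x_1,\ldots,x_n]$ is a polynomial ring over a field $k$, with monomials ordered lexicographically with $x_1>x_2>\cdots>x_n$. $d\geq 2$ is an integer and $\mathcal{M}_d$ is the set of monomials of degree $d$ in $S$. For $u,v\in\mathcal{M}_d$ with $u\geq_{lex}v$, the lexsegment is $\mathcal{L}(u,v)=\{w\in\mathcal{M}_d : u\geq_{lex}w\geq_{lex}v\}$; the ideal $(\mathcal{L}(u,v))$ has minimal monomial generating set $\mathcal{L}(u,v)$. The shadow of a set $T$ of monomials is $\mathrm{Shad}(T)=\{m x_i : m\in T,\ 1\le i\le n\}$, and $\mathrm{Shad}^i(T)=\mathrm{Shad}(\mathrm{Shad}^{i-1}(T))$. A lexsegment is a completely lexsegment if all its iterated shadows $\mathrm{Shad}^i$ are again lexsegments; a completely lexsegment ideal is an ideal generated by a completely lexsegment. An ideal generated in degree $d$ has a linear resolution if the $i$-th module in its minimal graded free resolution over $S$ is generated in degree $d+i$ for all $i\ge 0$. A monomial ideal $I$ with minimal monomial generating set $G(I)$ has linear quotients if there is an ordering $u_1,\ldots,u_m$ of $G(I)$ such that for all $2\le j\le m$ the colon ideal $(u_1,\ldots,u_{j-1}):u_j$ is generated by a subset of $\{x_1,\ldots,x_n\}$.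 *)

theory Defs
  imports "HOL-Library.Poly_Mapping" "Jordan_Normal_Form.Matrix_Kernel"
begin

section \<open>Monomials and polynomials\<close>

text \<open>
  The variables are indexed by a finite linearly ordered type \<open>'n\<close>; with \<open>n = CARD('n)\<close> its
  elements, listed increasingly, stand for \<open>1, \<dots>, n\<close>. A monomial is its exponent vector, and
  \<open>S = k[x_1, \<dots>, x_n]\<close> is the whole type \<open>('n, 'k) mpol\<close> (convolution product).

  The order of the library on \<open>'n mon\<close> is the lexicographic order with \<open>x_1 > \<dots> > x_n\<close>:
  \<open>w < u\<close> iff \<open>w\<close> has the smaller exponent at the least index at which \<open>w\<close> and \<open>u\<close> differ
  (see \<open>less_fun_def\<close>).
\<close>

type_synonym 'n mon = "'n \<Rightarrow>\<^sub>0 nat"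
type_synonym ('n, 'k) mpol = "'n mon \<Rightarrow>\<^sub>0 'k"

definition mdeg :: "'n::finite mon \<Rightarrow> nat" where
  "mdeg m = (\<Sum>i\<in>UNIV. Poly_Mapping.lookup m i)"

definition monomials :: "nat \<Rightarrow> 'n::finite mon set" where
  "monomials d = {m. mdeg m = d}"

definition mono_poly :: "'n mon \<Rightarrow> ('n, 'k::field) mpol" where
  "mono_poly m = Poly_Mapping.single m 1"

definition var_mon :: "'n \<Rightarrow> 'n mon" where
  "var_mon i = Poly_Mapping.single i 1"

definition var_poly :: "'n \<Rightarrow> ('n, 'k::field) mpol" where
  "var_poly i = mono_poly (var_mon i)"


section \<open>Ideals\<close>

text \<open>The ideal generated by \<open>X\<close> is the span of \<open>X\<close> in the ring regarded as a module over itself.\<close>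

definition ideal_gen :: "'a::comm_ring_1 set \<Rightarrow> 'a set" where
  "ideal_gen X = Modules.module.span (*) X"

definition monomial_ideal :: "'n mon set \<Rightarrow> ('n, 'k::field) mpol set" where
  "monomial_ideal T = ideal_gen (mono_poly ` T)"

definition colon_ideal :: "'a::comm_ring_1 set \<Rightarrow> 'a \<Rightarrow> 'a set" where
  "colon_ideal J f = {g. g * f \<in> J}"

definition minimal_monomial_generators :: "('n, 'k::field) mpol set \<Rightarrow> 'n mon set \<Rightarrow> bool" where
  "minimal_monomial_generators I G \<longleftrightarrow>
     monomial_ideal G = I \<and> (\<forall>G'. G' \<subset> G \<longrightarrow> (monomial_ideal G' :: ('n, 'k) mpol set) \<noteq> I)"


section \<open>Lexsegments\<close>

definition lexsegment :: "nat \<Rightarrow> 'n::{finite,linorder} mon \<Rightarrow> 'n mon \<Rightarrow> 'n mon set" where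
  "lexsegment d u v = {w \<in> monomials d. v \<le> w \<and> w \<le> u}"

definition is_lexsegment :: "'n::{finite,linorder} mon set \<Rightarrow> bool" where
  "is_lexsegment T \<longleftrightarrow>
     (\<exists>d. \<exists>u \<in> monomials d. \<exists>v \<in> monomials d. v \<le> u \<and> T = lexsegment d u v)"

definition shadow :: "'n mon set \<Rightarrow> 'n mon set" where
  "shadow T = {m + var_mon i | m i. m \<in> T}"

text \<open>The power \<open>i = 0\<close> says that \<open>T\<close> itself is a lexsegment.\<close>

definition completely_lexsegment :: "'n::{finite,linorder} mon set \<Rightarrow> bool" where
  "completely_lexsegment T \<longleftrightarrow> (\<forall>i. is_lexsegment ((shadow ^^ i) T))"

definition completely_lexsegment_ideal ::
    "('n::{finite,linorder}, 'k::field) mpol set \<Rightarrow> bool" where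
  "completely_lexsegment_ideal I \<longleftrightarrow> (\<exists>T. completely_lexsegment T \<and> I = monomial_ideal T)"


section \<open>Linear quotients\<close>

definition has_linear_quotients :: "('n, 'k::field) mpol set \<Rightarrow> bool" where
  "has_linear_quotients I \<longleftrightarrow>
     (\<exists>us. distinct us \<and> minimal_monomial_generators I (set us) \<and>
        (\<forall>j. 1 \<le> j \<and> j < length us \<longrightarrow>
           (\<exists>X. colon_ideal (monomial_ideal (set (take j us))) (mono_poly (us ! j))
                = (ideal_gen (var_poly ` X) :: ('n, 'k) mpol set))))"


section \<open>Minimal graded free resolutions\<close>

text \<open>
  A list \<open>es\<close> of degrees encodes the graded free module \<open>\<Oplus>\<^sub>j S(-es ! j)\<close>, whose \<open>j\<close>-th
  basis vector has degree \<open>es ! j\<close>; its elements are the vectors of dimension \<open>length es\<close> over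
  \<open>S\<close>. A homogeneous map of degree 0 from the module of \<open>es\<close> to that of \<open>ds\<close> is a matrix whose
  \<open>(i, j)\<close> entry is zero or homogeneous of degree \<open>es ! j - ds ! i\<close>.

  Natural numbers suffice as degrees: an ideal of \<open>S\<close> lives in nonnegative degrees, hence so do
  the generators of all modules in its minimal resolution.
\<close>

definition graded_map ::
    "nat list \<Rightarrow> nat list \<Rightarrow> ('n::finite, 'k::field) mpol mat \<Rightarrow> bool" where
  "graded_map ds es A \<longleftrightarrow>
     A \<in> carrier_mat (length ds) (length es) \<and>
     (\<forall>i < length ds. \<forall>j < length es. \<forall>m \<in> Poly_Mapping.keys (A $$ (i, j)).
        mdeg m + ds ! i = es ! j)"

definition mat_image :: "'a::comm_ring_1 mat \<Rightarrow> 'a vec set" where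
  "mat_image A = {A *\<^sub>v x | x. x \<in> carrier_vec (dim_col A)}"

text \<open>
  \<open>F i\<close> lists the degrees of the basis of the \<open>i\<close>-th module. The matrix \<open>\<phi> 0\<close> is the augmentation
  from the module of \<open>F 0\<close> to \<open>S\<close>, with image \<open>I\<close>, and \<open>\<phi> (Suc i)\<close> is the differential from the
  module of \<open>F (Suc i)\<close> to that of \<open>F i\<close>. Minimality means that the differentials have all their
  entries in the ideal \<open>(x_1, \<dots>, x_n)\<close>; it imposes nothing on the augmentation.
\<close>

definition minimal_graded_free_resolution ::
    "('n::finite, 'k::field) mpol set \<Rightarrow> (nat \<Rightarrow> nat list) \<Rightarrow> (nat \<Rightarrow> ('n, 'k) mpol mat) \<Rightarrow> bool" where
  "minimal_graded_free_resolution I F \<phi> \<longleftrightarrow>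
     graded_map [0] (F 0) (\<phi> 0) \<and>
     (\<forall>i. graded_map (F i) (F (Suc i)) (\<phi> (Suc i))) \<and>
     mat_image (\<phi> 0) = {vec 1 (\<lambda>_. f) | f. f \<in> I} \<and>
     (\<forall>i. mat_kernel (\<phi> i) = mat_image (\<phi> (Suc i))) \<and>
     (\<forall>i. elements_mat (\<phi> (Suc i)) \<subseteq> ideal_gen (range var_poly))"

text \<open>
  The minimal graded free resolution exists and is unique up to isomorphism, so it makes no
  difference to ask for one with the required degrees or to require them of all.
\<close>

definition has_linear_resolution :: "nat \<Rightarrow> ('n::finite, 'k::field) mpol set \<Rightarrow> bool" where
  "has_linear_resolution d I \<longleftrightarrow>
     (\<exists>F \<phi>. minimal_graded_free_resolution I F \<phi> \<and> (\<forall>i. \<forall>e \<in> set (F i). e = d + i))"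

end

theory Submission
  imports Defs "HOL-Library.Function_Algebras"
begin

text \<open>
  If \<open>I\<close> is generated in one degree and has linear quotients, then so has its syzygy module, with
  respect to the linear syzygies that witness the colon ideals; iterating gives a linear resolution.

  Conversely, split \<open>L(u, v)\<close> into the monomials divisible by \<open>x\<^sub>1\<close> and the others. If the first
  syzygies of \<open>I\<close> are linear, the intersection of the two ideals is generated in degree \<open>d + 1\<close>.
  When the shadow of \<open>L(u, v)\<close> is not a lexsegment, testing this on two pairs of monomials forces
  \<open>v = x\<^sub>l x\<^sub>n\<^sup>d\<^sup>-\<^sup>1\<close> and \<open>u = x\<^sub>1 u'\<close> with \<open>u'\<close> a monomial in the variables after \<open>x\<^sub>l\<close>. In this case
  there is an explicit order with linear quotients.
\<close>

text \<open>The resolution in the hypothesis comes with arbitrary homogeneous matrices: the basis of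
  its first module maps to forms of degree \<open>d\<close>, not to monomials, and no multigrading
  is given. The remedy is to project onto the monomials of one part of the generating set. This
  projection commutes only with scalars, so coefficients are cut down to degree 0 beforehand.

  The shape of the endpoints comes from a single witness, a \<open>w < v\<close> for which
  \<open>x_1 w\<close> is missing from the first shadow; higher shadows give nothing new. The
  explicit order reflects which endpoint restricts a monomial: those without \<open>x_1\<close> lie
  below \<open>u\<close> automatically and are listed downwards; those with \<open>x_1\<close> lie
  above \<open>v\<close> automatically and are listed upwards, after the others.\<close>

abbreviation "lkp \<equiv> Poly_Mapping.lookup"
abbreviation "keys \<equiv> Poly_Mapping.keys"

section \<open>Monomial ideals\<close>

definition mdvd :: "'n mon \<Rightarrow> 'n mon \<Rightarrow> bool" where
  "mdvd s t \<longleftrightarrow> (\<forall>i. lkp s i \<le> lkp t i)"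

lemma mdvd_iff: "mdvd s t \<longleftrightarrow> (\<exists>r. t = s + r)"
proof
  assume "mdvd s t"
  then have "t = s + (t - s)"
    by (intro poly_mapping_eqI) (simp add: mdvd_def lookup_add lookup_minus)
  then show "\<exists>r. t = s + r" ..
qed (auto simp: mdvd_def lookup_add)

lemma mdvd_refl [simp]: "mdvd s s"
  by (simp add: mdvd_def)

lemma mdvd_trans: "mdvd r s \<Longrightarrow> mdvd s t \<Longrightarrow> mdvd r t"
  unfolding mdvd_def using le_trans by blast

lemma mdvd_add [intro]: "mdvd s t \<Longrightarrow> mdvd s (r + t)"
  by (simp add: mdvd_def lookup_add trans_le_add2)

lemma lookup_var_mon: "lkp (var_mon i) j = (if j = i then 1 else 0)"
  by (simp add: var_mon_def lookup_single when_def)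

lemma mdvd_var_mon: "mdvd (var_mon i) t \<longleftrightarrow> lkp t i > 0"
  by (auto simp: mdvd_def lookup_var_mon Suc_le_eq)

lemma mdeg_add [simp]: "mdeg (s + t) = mdeg s + mdeg t"
  by (simp add: mdeg_def lookup_add sum.distrib)

lemma mdeg_var_mon [simp]: "mdeg (var_mon i) = 1"
  by (simp add: mdeg_def lookup_var_mon)

lemma mdeg_eq_0 [simp]: "mdeg t = 0 \<longleftrightarrow> t = 0"
  by (auto simp: mdeg_def intro!: poly_mapping_eqI)

lemma mdvd_mdeg_eq:
  assumes "mdvd s t" "mdeg s = mdeg t"
  shows "s = t"
  using assms by (auto simp: mdvd_iff)

lemma key_addend:
  assumes "lkp t i > 0"
  obtains s where "t = s + var_mon i"
  using assms mdvd_var_mon mdvd_iff by (metis add.commute)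

lemma poly_sum_single:
  fixes p :: "'a \<Rightarrow>\<^sub>0 'b::comm_monoid_add"
  shows "p = (\<Sum>t\<in>keys p. Poly_Mapping.single t (lkp p t))"
proof (rule poly_mapping_eqI)
  fix s
  have "(\<Sum>t\<in>keys p. lkp (Poly_Mapping.single t (lkp p t)) s) = (\<Sum>t\<in>keys p. if t = s then lkp p s else 0)"
    by (intro sum.cong refl) (simp add: lookup_single when_def)
  also have "\<dots> = lkp p s"
    by (simp add: in_keys_iff)
  finally show "lkp p s = lkp (\<Sum>t\<in>keys p. Poly_Mapping.single t (lkp p t)) s"
    by (simp add: lookup_sum)
qed

lemma lookup_mono_poly_mult [simp]:
  fixes p :: "('n, 'k::field) mpol"
  shows "lkp (mono_poly m * p) (m + t) = lkp p t"
proof -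
  have "mono_poly m * p = (\<Sum>s\<in>keys p. Poly_Mapping.single (m + s) (lkp p s))"
    unfolding mono_poly_def
    by (subst poly_sum_single [of p], subst sum_distrib_left)
       (intro sum.cong refl, simp add: mult_single)
  then have "lkp (mono_poly m * p) (m + t) = (\<Sum>s\<in>keys p. if s = t then lkp p t else 0)"
    by (simp only: lookup_sum) (intro sum.cong refl, auto simp: lookup_single when_def)
  then show ?thesis
    by (simp add: in_keys_iff)
qed

lemma keys_mono_poly [simp]: "keys (mono_poly m :: ('n, 'k::field) mpol) = {m}"
  by (simp add: mono_poly_def)

lemma keys_mono_poly_mult:
  "keys (mono_poly m * p :: ('n, 'k::field) mpol) = (\<lambda>t. m + t) ` keys p"
proof
  show "keys (mono_poly m * p) \<subseteq> (\<lambda>t. m + t) ` keys p"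
    using keys_mult [of "mono_poly m" p] by auto
  show "(\<lambda>t. m + t) ` keys p \<subseteq> keys (mono_poly m * p)"
    by (auto simp: in_keys_iff)
qed

lemma mono_poly_add:
  "(mono_poly (s + t) :: ('n, 'k::field) mpol) = mono_poly s * mono_poly t"
  by (simp add: mono_poly_def mult_single)

interpretation rmod: Modules.module "(*) :: 'a::comm_ring_1 \<Rightarrow> 'a \<Rightarrow> 'a"
  by unfold_locales (simp_all add: algebra_simps)

text \<open>As a simplification rule this loops with \<open>mult.assoc\<close>.\<close>
declare rmod.scale_scale [simp del]

lemma monomial_ideal_iff:
  fixes p :: "('n, 'k::field) mpol"
  shows "p \<in> monomial_ideal T \<longleftrightarrow> (\<forall>t\<in>keys p. \<exists>m\<in>T. mdvd m t)"
proof
  define J :: "('n, 'k) mpol set" where "J = {p. \<forall>t\<in>keys p. \<exists>m\<in>T. mdvd m t}"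
  have "rmod.subspace J"
  proof (rule rmod.subspaceI)
    fix p q assume "p \<in> J" "q \<in> J"
    then show "p + q \<in> J"
      using Poly_Mapping.keys_add [of p q] unfolding J_def by blast
  next
    fix c p assume p: "p \<in> J"
    show "c * p \<in> J"
      unfolding J_def
    proof (intro CollectI ballI)
      fix t assume "t \<in> keys (c * p)"
      then obtain a b where "b \<in> keys p" "t = a + b"
        using keys_mult [of c p] by auto
      with p show "\<exists>m\<in>T. mdvd m t" unfolding J_def by blast
    qed
  qed (simp add: J_def)
  moreover have "mono_poly ` T \<subseteq> J" by (auto simp: J_def) (use mdvd_refl in blast)
  ultimately have "monomial_ideal T \<subseteq> J"
    unfolding monomial_ideal_def ideal_gen_def by (rule rmod.span_minimal[rotated])
  then show "p \<in> monomial_ideal T \<Longrightarrow> \<forall>t\<in>keys p. \<exists>m\<in>T. mdvd m t"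
    by (auto simp: J_def)
next
  assume *: "\<forall>t\<in>keys p. \<exists>m\<in>T. mdvd m t"
  have "(\<Sum>t\<in>keys p. Poly_Mapping.single t (lkp p t)) \<in> monomial_ideal T"
    unfolding monomial_ideal_def ideal_gen_def
  proof (rule rmod.span_sum)
    fix t assume "t \<in> keys p"
    with * obtain m r where m: "m \<in> T" "t = m + r" by (auto simp: mdvd_iff)
    then have "Poly_Mapping.single t (lkp p t) = Poly_Mapping.single r (lkp p t) * mono_poly m"
      by (simp add: mono_poly_def mult_single add.commute)
    with m(1) show "Poly_Mapping.single t (lkp p t) \<in> rmod.span (mono_poly ` T)"
      by (auto intro: rmod.span_scale rmod.span_base)
  qed
  then show "p \<in> monomial_ideal T"
    using poly_sum_single [of p] by simp
qed

lemma mono_poly_in_monomial_ideal: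
  "(mono_poly t :: ('n, 'k::field) mpol) \<in> monomial_ideal T \<longleftrightarrow> (\<exists>m\<in>T. mdvd m t)"
  by (simp add: monomial_ideal_iff)

lemma ideal_gen_var_poly: "ideal_gen (var_poly ` X) = monomial_ideal (var_mon ` X)"
  by (simp add: monomial_ideal_def var_poly_def image_image)

lemma in_ideal_gen_var_poly:
  fixes p :: "('n, 'k::field) mpol"
  shows "p \<in> ideal_gen (var_poly ` X) \<longleftrightarrow> (\<forall>t\<in>keys p. \<exists>x\<in>X. lkp t x > 0)"
  by (simp add: ideal_gen_var_poly monomial_ideal_iff mdvd_var_mon)

text \<open>Multiplication by a variable outside \<open>X\<close> does not change whether a monomial
  meets \<open>X\<close>. This bounds the colon ideals of the syzygies from above.\<close>

lemma var_ideal_prime: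
  fixes g :: "('n, 'k::field) mpol"
  assumes "g * var_poly y \<in> ideal_gen (var_poly ` X)" "y \<notin> X"
  shows "g \<in> ideal_gen (var_poly ` X)"
  unfolding in_ideal_gen_var_poly
proof
  fix t assume "t \<in> keys g"
  then have "var_mon y + t \<in> keys (g * var_poly y)"
    by (simp add: var_poly_def keys_mono_poly_mult mult.commute [of g])
  with assms(1) obtain x where "x \<in> X" "lkp (var_mon y + t) x > 0"
    unfolding in_ideal_gen_var_poly by blast
  with assms(2) show "\<exists>x\<in>X. lkp t x > 0"
    by (auto simp: lookup_add lookup_var_mon split: if_splits)
qed

text \<open>The colon ideal is generated by the quotients \<open>s / gcd(s, m)\<close>. The first
  hypothesis makes each of them divisible by a variable of \<open>X\<close>, the second puts each
  variable of \<open>X\<close> into the colon ideal.\<close>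

lemma colon_monomial_ideal_eq_vars:
  fixes T :: "'n mon set"
  assumes "\<And>s. s \<in> T \<Longrightarrow> \<exists>x\<in>X. lkp s x > lkp m x"
    and "\<And>x. x \<in> X \<Longrightarrow> \<exists>s\<in>T. mdvd s (m + var_mon x)"
  shows "colon_ideal (monomial_ideal T) (mono_poly m)
    = (ideal_gen (var_poly ` X) :: ('n, 'k::field) mpol set)"
proof -
  have "(\<exists>s\<in>T. mdvd s (m + t)) \<longleftrightarrow> (\<exists>x\<in>X. lkp t x > 0)" for t
  proof
    assume "\<exists>s\<in>T. mdvd s (m + t)"
    then obtain s x where "mdvd s (m + t)" "x \<in> X" "lkp s x > lkp m x"
      using assms(1) by blast
    then have "lkp t x > 0"
      by (metis add_cancel_right_right gr0I leD lookup_add mdvd_def)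
    with \<open>x \<in> X\<close> show "\<exists>x\<in>X. lkp t x > 0" ..
  next
    assume "\<exists>x\<in>X. lkp t x > 0"
    then obtain x r where "x \<in> X" "t = r + var_mon x"
      using key_addend by metis
    then show "\<exists>s\<in>T. mdvd s (m + t)"
      using assms(2) [OF \<open>x \<in> X\<close>] mdvd_add [of _ "m + var_mon x" r] by (metis add.left_commute)
  qed
  then show ?thesis
    by (auto simp: colon_ideal_def monomial_ideal_iff in_ideal_gen_var_poly
        keys_mono_poly_mult mult.commute [of _ "mono_poly m"])
qed

section \<open>Homogeneous components\<close>

definition homog :: "nat \<Rightarrow> ('n::finite, 'k::field) mpol \<Rightarrow> bool" where
  "homog k p \<longleftrightarrow> (\<forall>t\<in>keys p. mdeg t = k)"

definition hcomp :: "nat \<Rightarrow> ('n::finite, 'k::field) mpol \<Rightarrow> ('n, 'k) mpol" where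
  "hcomp k p = Poly_Mapping.mapp (\<lambda>t c. c when mdeg t = k) p"

lemma lookup_hcomp: "lkp (hcomp k p) t = (if mdeg t = k then lkp p t else 0)"
  by (simp add: hcomp_def lookup_mapp when_def in_keys_iff)

lemma homog_hcomp [simp]: "homog k (hcomp k p)"
  by (auto simp: homog_def in_keys_iff lookup_hcomp split: if_splits)

lemma homog_0 [simp]: "homog k 0"
  by (simp add: homog_def)

lemma homog_mult: "homog k p \<Longrightarrow> homog l q \<Longrightarrow> homog (k + l) (p * q)"
  using keys_mult [of p q] by (fastforce simp: homog_def)

lemma homog_uminus [simp]: "homog k (- p) \<longleftrightarrow> homog k p"
  by (simp add: homog_def in_keys_iff)

lemma homog_mono_poly [simp]: "homog k (mono_poly m) \<longleftrightarrow> mdeg m = k"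
  by (simp add: homog_def)

lemma hcomp_homog: "homog k p \<Longrightarrow> hcomp k p = p"
  by (rule poly_mapping_eqI) (auto simp: lookup_hcomp homog_def in_keys_iff)

lemma hcomp_add: "hcomp k (p + q) = hcomp k p + hcomp k q"
  by (rule poly_mapping_eqI) (simp add: lookup_hcomp lookup_add)

lemma hcomp_sum: "hcomp k (\<Sum>i\<in>A. f i) = (\<Sum>i\<in>A. hcomp k (f i))"
  by (rule poly_mapping_eqI) (simp add: lookup_hcomp lookup_sum)

lemma hcomp_mult_homog:
  assumes "homog l q"
  shows "hcomp (k + l) (p * q) = hcomp k p * q"
proof -
  define r where "r = p - hcomp k p"
  have r: "t \<in> keys r \<Longrightarrow> mdeg t \<noteq> k" for t
    by (auto simp: r_def in_keys_iff lookup_minus lookup_hcomp)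
  have "mdeg t \<noteq> k + l" if "t \<in> keys (r * q)" for t
  proof -
    from that keys_mult [of r q] obtain a b where "a \<in> keys r" "b \<in> keys q" "t = a + b" by auto
    with r [of a] assms show ?thesis by (auto simp: homog_def)
  qed
  then have "hcomp (k + l) (r * q) = 0"
    by (intro poly_mapping_eqI) (metis in_keys_iff lookup_hcomp lookup_zero)
  moreover have "p * q = hcomp k p * q + r * q"
    by (simp add: r_def algebra_simps)
  ultimately show ?thesis
    by (simp add: hcomp_add hcomp_homog homog_mult assms)
qed

section \<open>Linear quotients for modules and their syzygies\<close>

text \<open>Vectors of all free modules share one type of functions on the natural numbers, so the
  rank may change along the resolution. Support conditions take the place of a dimension.\<close>

definition vscale :: "'a::comm_ring_1 \<Rightarrow> (nat \<Rightarrow> 'a) \<Rightarrow> nat \<Rightarrow> 'a" where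
  "vscale c f = (\<lambda>i. c * f i)"

interpretation vmod: Modules.module "vscale :: 'a::comm_ring_1 \<Rightarrow> (nat \<Rightarrow> 'a) \<Rightarrow> nat \<Rightarrow> 'a"
  by unfold_locales (auto simp: vscale_def distrib_left distrib_right mult.assoc)

text \<open>Linear quotients for a list of vectors. Unlike the definition for ideals, the condition
  already applies to the first generator, where it concerns the annihilator of that vector.\<close>

inductive lin_quot :: "(nat \<Rightarrow> ('n, 'k::field) mpol) list \<Rightarrow> bool" where
  Nil: "lin_quot []"
| snoc: "lin_quot bs \<Longrightarrow> {g. vscale g b \<in> vmod.span (set bs)} = ideal_gen (var_poly ` X)
    \<Longrightarrow> lin_quot (bs @ [b])"

definition lincomb :: "(nat \<Rightarrow> 'a::comm_ring_1) list \<Rightarrow> (nat \<Rightarrow> 'a) \<Rightarrow> nat \<Rightarrow> 'a" where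
  "lincomb as c = (\<lambda>i. \<Sum>j<length as. c j * (as ! j) i)"

definition syzygies :: "(nat \<Rightarrow> 'a::comm_ring_1) list \<Rightarrow> (nat \<Rightarrow> 'a) set" where
  "syzygies as = {c. (\<forall>i\<ge>length as. c i = 0) \<and> lincomb as c = 0}"

definition vhomog :: "nat \<Rightarrow> (nat \<Rightarrow> ('n::finite, 'k::field) mpol) \<Rightarrow> bool" where
  "vhomog k f \<longleftrightarrow> (\<forall>i. homog k (f i))"

lemma lincomb_add: "lincomb as (b + c) = lincomb as b + lincomb as c"
  by (rule ext) (simp add: lincomb_def distrib_right sum.distrib)

lemma lincomb_diff: "lincomb as (b - c) = lincomb as b - lincomb as c"
  by (rule ext) (simp add: lincomb_def left_diff_distrib sum_subtractf)

lemma lincomb_scale: "lincomb as (vscale a c) = vscale a (lincomb as c)"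
  by (simp add: lincomb_def vscale_def fun_eq_iff sum_distrib_left mult.assoc)

lemma lincomb_snoc: "lincomb (as @ [a]) c = lincomb as c + vscale (c (length as)) a"
  by (simp add: lincomb_def vscale_def fun_eq_iff nth_append)

lemma span_lincomb: "vmod.span (set as) = range (lincomb as)"
proof
  have "vmod.subspace (range (lincomb as))"
  proof (rule vmod.subspaceI)
    have "lincomb as 0 = 0" by (simp add: lincomb_def fun_eq_iff)
    then show "0 \<in> range (lincomb as)" by (metis rangeI)
  qed (auto simp flip: lincomb_add lincomb_scale)
  moreover have "as ! j = lincomb as (\<lambda>i. if i = j then 1 else 0)" if "j < length as" for j
    using that by (simp add: lincomb_def fun_eq_iff if_distrib [of "\<lambda>x. x * _"] cong: if_cong)
  then have "set as \<subseteq> range (lincomb as)"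
    by (auto simp: in_set_conv_nth)
  ultimately show "vmod.span (set as) \<subseteq> range (lincomb as)"
    by (rule vmod.span_minimal[rotated])
  have "lincomb as c = (\<Sum>j<length as. vscale (c j) (as ! j))" for c
  proof (induction as rule: rev_induct)
    case (snoc a as)
    then show ?case by (simp add: lincomb_snoc nth_append)
  qed (simp add: lincomb_def fun_eq_iff)
  then show "range (lincomb as) \<subseteq> vmod.span (set as)"
    by (auto intro!: vmod.span_sum vmod.span_scale intro: vmod.span_base)
qed

lemma subspace_syzygies: "vmod.subspace (syzygies as)"
proof (rule vmod.subspaceI)
  show "0 \<in> syzygies as"
    by (simp add: syzygies_def lincomb_def fun_eq_iff)
qed (simp_all add: syzygies_def lincomb_add lincomb_scale, simp_all add: vscale_def fun_eq_iff)

text \<open>In any representation of \<open>b\<close> only the degree 1 parts of the coefficients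
  contribute to degree \<open>1 + e\<close>, so the others may be dropped. Coefficients past the end
  of the list are set to zero, as a syzygy requires.\<close>

lemma homog_coeffs:
  assumes "\<forall>a\<in>set as. vhomog e a" "vhomog (1 + e) b" "b \<in> vmod.span (set as)"
  obtains c where "b = lincomb as c" "\<And>i. homog 1 (c i)" "\<And>i. i \<ge> length as \<Longrightarrow> c i = 0"
proof -
  from assms(3) obtain c where c: "b = lincomb as c" by (auto simp: span_lincomb)
  define c' where "c' i = (if i < length as then hcomp 1 (c i) else 0)" for i
  have "b = lincomb as c'"
  proof
    fix i
    have "b i = hcomp (1 + e) (b i)"
      using assms(2) by (metis hcomp_homog vhomog_def)
    also have "\<dots> = (\<Sum>j<length as. hcomp (1 + e) (c j * (as ! j) i))"
      by (simp add: c lincomb_def hcomp_sum)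
    also have "\<dots> = (\<Sum>j<length as. c' j * (as ! j) i)"
      using assms(1) by (intro sum.cong refl) (simp add: hcomp_mult_homog [of e _ 1, simplified] c'_def vhomog_def)
    finally show "b i = lincomb as c' i" by (simp add: lincomb_def)
  qed
  moreover have "homog 1 (c' i)" for i by (simp add: c'_def)
  ultimately show ?thesis using that [of c'] by (simp add: c'_def)
qed

text \<open>
  If the colon ideal of the generator \<open>a\<^sub>j\<close> is generated by variables \<open>x\<close>, each of them gives a linear
  syzygy \<open>\<sigma>\<^sub>j\<^sub>x\<close> with last entry \<open>x\<close>. Ordered by \<open>j\<close> first, these have linear quotients again:
  modulo the earlier ones, \<open>\<sigma>\<^sub>j\<^sub>x\<close> is annihilated exactly by the earlier variables of the same \<open>j\<close>.
\<close>

lemma lin_quot_syzygies: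
  fixes as :: "(nat \<Rightarrow> ('n::finite, 'k::field) mpol) list"
  assumes "lin_quot as" "\<forall>a\<in>set as. vhomog e a"
  shows "\<exists>bs. lin_quot bs \<and> (\<forall>b\<in>set bs. vhomog 1 b) \<and> vmod.span (set bs) = syzygies as"
  using assms
proof (induction rule: lin_quot.induct)
  case Nil
  have "syzygies [] = {0 :: nat \<Rightarrow> ('n, 'k) mpol}"
    by (auto simp: syzygies_def lincomb_def fun_eq_iff)
  then show ?case
    by (intro exI [of _ "[]"]) (simp add: lin_quot.Nil)
next
  case (snoc as a X)
  let ?n = "length as"
  obtain bs where bs: "lin_quot bs" "\<forall>b\<in>set bs. vhomog 1 b" "vmod.span (set bs) = syzygies as"
    using snoc.IH snoc.prems by auto
  have bs_n: "b ?n = 0" if "b \<in> vmod.span (set bs)" for b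
    using that bs(3) by (simp add: syzygies_def)
  have colon: "vscale g a \<in> vmod.span (set as) \<longleftrightarrow> g \<in> ideal_gen (var_poly ` X)" for g
    using snoc.hyps(2) by blast
  have "\<exists>s. s \<in> syzygies (as @ [a]) \<and> s ?n = var_poly x \<and> vhomog 1 s" if "x \<in> X" for x
  proof -
    have "homog (1 + e) (var_poly x * a i)" for i
      using snoc.prems by (intro homog_mult) (auto simp: var_poly_def vhomog_def)
    then have "vhomog (1 + e) (vscale (var_poly x) a)"
      by (simp add: vhomog_def vscale_def)
    moreover have "vscale (var_poly x) a \<in> vmod.span (set as)"
      unfolding colon ideal_gen_def by (rule rmod.span_base) (use that in blast)
    ultimately obtain c where c: "vscale (var_poly x) a = lincomb as c" "\<And>i. homog 1 (c i)"
        "\<And>i. i \<ge> ?n \<Longrightarrow> c i = 0"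
      using homog_coeffs snoc.prems by (metis Un_iff set_append)
    \<comment> \<open>A representation of \<open>x a\<close> by the earlier generators, moved to the
      other side, is the syzygy with last entry \<open>x\<close>.\<close>
    define s where "s i = (if i = ?n then var_poly x else - c i)" for i
    have "lincomb as s = - lincomb as c"
      by (simp add: lincomb_def s_def fun_eq_iff sum_negf)
    then have "lincomb (as @ [a]) s = 0"
      by (simp add: lincomb_snoc c(1) [symmetric] s_def)
    moreover have "vhomog 1 s"
      using c(2) by (simp add: vhomog_def s_def var_poly_def)
    ultimately show ?thesis
      using c(3) by (intro exI [of _ s]) (auto simp: syzygies_def s_def)
  qed
  then obtain \<sigma> where \<sigma>: "\<And>x. x \<in> X \<Longrightarrow> \<sigma> x \<in> syzygies (as @ [a])"
      "\<And>x. x \<in> X \<Longrightarrow> \<sigma> x ?n = var_poly x" "\<And>x. x \<in> X \<Longrightarrow> vhomog 1 (\<sigma> x)"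
    by metis
  \<comment> \<open>Taking the last entry maps the syzygies of \<open>as @ [a]\<close> onto the
    ideal generated by \<open>X\<close>, and its kernel is the syzygies of \<open>as\<close>. The
    rest of the proof works along this exact sequence.\<close>
  have restrict: "s \<in> vmod.span (set bs)" if "s \<in> syzygies (as @ [a])" "s ?n = 0" for s
    using that unfolding bs(3) syzygies_def
    by (auto simp: lincomb_snoc vscale_def fun_eq_iff) (metis le_less_Suc_eq not_le)
  have last: "s ?n \<in> ideal_gen (var_poly ` Y)"
    if "s \<in> vmod.span (set bs \<union> \<sigma> ` Y)" "Y \<subseteq> X" for s Y
  proof -
    have "vmod.subspace {s. s ?n \<in> ideal_gen (var_poly ` Y)}"
      unfolding ideal_gen_def
      by (rule vmod.subspaceI) (simp_all add: vscale_def rmod.span_add rmod.span_scale rmod.span_zero)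
    moreover have "s ?n \<in> ideal_gen (var_poly ` Y)" if "s \<in> set bs" for s
      using bs_n [OF vmod.span_base [OF that]] by (simp add: ideal_gen_def rmod.span_zero)
    moreover have "\<sigma> x ?n \<in> ideal_gen (var_poly ` Y)" if "x \<in> Y" for x
      using that \<open>Y \<subseteq> X\<close> \<sigma>(2) [of x] by (auto simp: ideal_gen_def intro: rmod.span_base)
    ultimately have "vmod.span (set bs \<union> \<sigma> ` Y) \<subseteq> {s. s ?n \<in> ideal_gen (var_poly ` Y)}"
      by (intro vmod.span_minimal) auto
    then show ?thesis
      using that(1) by auto
  qed
  have lq: "lin_quot (bs @ map \<sigma> ys)" if "distinct ys" "set ys \<subseteq> X" for ys
    using that
  proof (induction ys rule: rev_induct)
    case Nil
    then show ?case using bs by simp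
  next
    case (snoc y ys)
    then have y: "y \<in> X" "y \<notin> set ys" and ys: "set ys \<subseteq> X" by auto
    let ?B = "set (bs @ map \<sigma> ys)"
    have "{g. vscale g (\<sigma> y) \<in> vmod.span ?B} = ideal_gen (var_poly ` set ys)"
    proof (intro Set.equalityI subsetI CollectI; (elim CollectE)?)
      fix g assume "vscale g (\<sigma> y) \<in> vmod.span ?B"
      then have "vscale g (\<sigma> y) ?n \<in> ideal_gen (var_poly ` set ys)"
        using last ys by simp
      then show "g \<in> ideal_gen (var_poly ` set ys)"
        using var_ideal_prime y by (simp add: vscale_def \<sigma>(2))
    next
      have "vmod.subspace (vmod.span ?B)" by simp
      then have "rmod.subspace {g. vscale g (\<sigma> y) \<in> vmod.span ?B}"
        by (intro rmod.subspaceI)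
          (simp_all add: vmod.scale_left_distrib vmod.span_add vmod.span_scale vmod.span_zero
            flip: vmod.scale_scale)
      moreover have "vscale (var_poly z) (\<sigma> y) \<in> vmod.span ?B" if "z \<in> set ys" for z
      proof -
        have z: "z \<in> X" using that ys by auto
        \<comment> \<open>The Koszul relation between the last entries \<open>y\<close> and
          \<open>z\<close> makes the last entry vanish, so this combination already lies in the span
          of \<open>bs\<close>.\<close>
        let ?s = "vscale (var_poly z) (\<sigma> y) - vscale (var_poly y) (\<sigma> z)"
        have "?s \<in> vmod.span (set bs)"
        proof (rule restrict)
          show "?s \<in> syzygies (as @ [a])"
            using subspace_syzygies \<sigma>(1) y z
            by (intro vmod.subspace_diff vmod.subspace_scale) auto
          show "?s ?n = 0" by (simp add: vscale_def \<sigma>(2) y z)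
        qed
        then have "?s \<in> vmod.span ?B"
          using vmod.span_mono [of "set bs" ?B] by auto
        moreover have "vscale (var_poly y) (\<sigma> z) \<in> vmod.span ?B"
          using that by (intro vmod.span_scale vmod.span_base) auto
        ultimately show ?thesis
          using vmod.span_add_eq2 [of "vscale (var_poly y) (\<sigma> z)" ?B ?s] vmod.span_add by fastforce
      qed
      ultimately have "rmod.span (var_poly ` set ys) \<subseteq> {g. vscale g (\<sigma> y) \<in> vmod.span ?B}"
        by (intro rmod.span_minimal) auto
      then show "vscale g (\<sigma> y) \<in> vmod.span ?B" if "g \<in> ideal_gen (var_poly ` set ys)" for g
        using that by (auto simp: ideal_gen_def)
    qed
    then have "lin_quot ((bs @ map \<sigma> ys) @ [\<sigma> y])"
      using snoc by (intro lin_quot.snoc) auto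
    then show ?case by simp
  qed
  obtain xs where xs: "distinct xs" "set xs = X"
    using finite_distinct_list [of X] by auto
  let ?B = "bs @ map \<sigma> xs"
  have sub: "set ?B \<subseteq> syzygies (as @ [a])"
  proof -
    have "s \<in> syzygies (as @ [a])" if "s \<in> syzygies as" for s
      using that by (auto simp: syzygies_def lincomb_snoc vscale_def fun_eq_iff)
    then show ?thesis
      using bs(3) vmod.span_base \<sigma>(1) xs(2) by auto
  qed
  have "syzygies (as @ [a]) \<subseteq> vmod.span (set ?B)"
  proof
    fix c assume c: "c \<in> syzygies (as @ [a])"
    have "lincomb as 0 = 0" by (simp add: lincomb_def fun_eq_iff)
    moreover have "lincomb as c + vscale (c ?n) a = 0"
      using c by (simp add: syzygies_def lincomb_snoc)
    ultimately have "vscale (c ?n) a = lincomb as (0 - c)"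
      unfolding lincomb_diff by (metis add_eq_0_iff diff_0)
    then have "c ?n \<in> rmod.span (var_poly ` X)"
      using colon span_lincomb unfolding ideal_gen_def by blast
    \<comment> \<open>The last entries of the span form an ideal containing the variables of
      \<open>X\<close>. Hence some \<open>s\<close> in the span has the same last entry as
      \<open>c\<close>, and \<open>c - s\<close> falls into the kernel.\<close>
    moreover have "rmod.subspace ((\<lambda>s. s ?n) ` vmod.span (set ?B))"
    proof (rule rmod.subspaceI; (elim imageE)?)
      show "0 \<in> (\<lambda>s. s ?n) ` vmod.span (set ?B)"
        using vmod.span_zero by (intro image_eqI [of _ _ 0]) auto
      show "x + y \<in> (\<lambda>s. s ?n) ` vmod.span (set ?B)"
        if "x = s ?n" "s \<in> vmod.span (set ?B)" "y = t ?n" "t \<in> vmod.span (set ?B)" for x y s t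
        using that by (intro image_eqI [of _ _ "s + t"] vmod.span_add) auto
      show "k * x \<in> (\<lambda>s. s ?n) ` vmod.span (set ?B)"
        if "x = s ?n" "s \<in> vmod.span (set ?B)" for k x s
        using that by (intro image_eqI [of _ _ "vscale k s"] vmod.span_scale) (auto simp: vscale_def)
    qed
    moreover have "var_poly ` X \<subseteq> (\<lambda>s. s ?n) ` vmod.span (set ?B)"
    proof
      fix p :: "('n, 'k) mpol" assume "p \<in> var_poly ` X"
      then obtain x where "x \<in> X" "p = \<sigma> x ?n" using \<sigma>(2) by auto
      moreover have "\<sigma> x \<in> vmod.span (set ?B)"
        using \<open>x \<in> X\<close> xs(2) by (intro vmod.span_base) auto
      ultimately show "p \<in> (\<lambda>s. s ?n) ` vmod.span (set ?B)" by blast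
    qed
    ultimately obtain s where s: "s \<in> vmod.span (set ?B)" "c ?n = s ?n"
      using rmod.span_minimal by (metis (no_types, lifting) imageE subsetD)
    have "s \<in> syzygies (as @ [a])"
      using s(1) sub vmod.span_minimal [OF sub subspace_syzygies] by blast
    then have "c - s \<in> vmod.span (set bs)"
      using c s(2) by (intro restrict vmod.subspace_diff subspace_syzygies) auto
    then have "c - s \<in> vmod.span (set ?B)"
      using vmod.span_mono [of "set bs" "set ?B"] by auto
    with s(1) show "c \<in> vmod.span (set ?B)"
      using vmod.span_add by fastforce
  qed
  then have "vmod.span (set ?B) = syzygies (as @ [a])"
    using vmod.span_minimal [OF sub subspace_syzygies] by blast
  moreover have "\<forall>b\<in>set ?B. vhomog 1 b"
    using bs(2) \<sigma>(3) xs(2) by auto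
  ultimately show ?case
    using lq [of xs] xs by blast
qed

section \<open>Linear quotients imply a linear resolution\<close>

text \<open>The bridge from vectors as functions to the matrices of the resolution; coordinates from
  \<open>r\<close> on are cut off.\<close>

definition cols_mat :: "nat \<Rightarrow> (nat \<Rightarrow> 'a::comm_ring_1) list \<Rightarrow> 'a mat" where
  "cols_mat r as = mat r (length as) (\<lambda>(i, j). (as ! j) i)"

lemma cols_mat_dim [simp]:
  "dim_row (cols_mat r as) = r" "dim_col (cols_mat r as) = length as"
  by (simp_all add: cols_mat_def)

lemma cols_mat_mult:
  assumes "x \<in> carrier_vec (length as)" "\<And>j. j < length as \<Longrightarrow> x $ j = c j"
  shows "cols_mat r as *\<^sub>v x = vec r (lincomb as c)"
proof (rule eq_vecI)
  fix i assume i: "i < dim_vec (vec r (lincomb as c))"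
  have "(\<Sum>j = 0..<length as. (as ! j) i * x $ j) = (\<Sum>j = 0..<length as. c j * (as ! j) i)"
    using assms(2) by (intro sum.cong refl) (simp add: mult.commute)
  then show "(cols_mat r as *\<^sub>v x) $ i = vec r (lincomb as c) $ i"
    using i assms(1) by (simp add: cols_mat_def scalar_prod_def lincomb_def lessThan_atLeast0)
qed simp

lemma mat_image_cols_mat: "mat_image (cols_mat r as) = vec r ` vmod.span (set as)"
proof
  show "mat_image (cols_mat r as) \<subseteq> vec r ` vmod.span (set as)"
    by (auto simp: mat_image_def span_lincomb cols_mat_mult [where c = "\<lambda>j. _ $ j"])
  show "vec r ` vmod.span (set as) \<subseteq> mat_image (cols_mat r as)"
  proof (clarsimp simp: span_lincomb)
    fix c
    have "cols_mat r as *\<^sub>v vec (length as) c = vec r (lincomb as c)"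
      by (rule cols_mat_mult) auto
    then show "vec r (lincomb as c) \<in> mat_image (cols_mat r as)"
      unfolding mat_image_def by (metis (mono_tags, lifting) CollectI cols_mat_dim(2) vec_carrier)
  qed
qed

text \<open>The truncation to \<open>r\<close> rows loses no equation because the generators vanish
  from row \<open>r\<close> on.\<close>

lemma mat_kernel_cols_mat:
  assumes "\<And>a i. a \<in> set as \<Longrightarrow> i \<ge> r \<Longrightarrow> a i = 0"
  shows "mat_kernel (cols_mat r as) = vec (length as) ` syzygies as"
proof
  have zero: "lincomb as c = 0" if "vec r (lincomb as c) = 0\<^sub>v r" for c
  proof
    fix i show "lincomb as c i = 0 i"
    proof (cases "i < r")
      case True
      then show ?thesis using arg_cong [OF that, of "\<lambda>v. v $ i"] by simp
    next
      case False
      then show ?thesis using assms [OF nth_mem, of _ i] by (simp add: lincomb_def)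
    qed
  qed
  show "mat_kernel (cols_mat r as) \<subseteq> vec (length as) ` syzygies as"
  proof
    fix x assume "x \<in> mat_kernel (cols_mat r as)"
    then have x: "x \<in> carrier_vec (length as)" "cols_mat r as *\<^sub>v x = 0\<^sub>v r"
      by (simp_all add: mat_kernel_def)
    define c where "c j = (if j < length as then x $ j else 0)" for j
    have "c \<in> syzygies as"
      using zero [of c] cols_mat_mult [OF x(1), of c r] x(2)
      by (simp add: syzygies_def c_def)
    moreover have "x = vec (length as) c"
      using x(1) by (intro eq_vecI) (auto simp: c_def)
    ultimately show "x \<in> vec (length as) ` syzygies as" by blast
  qed
  show "vec (length as) ` syzygies as \<subseteq> mat_kernel (cols_mat r as)"
  proof clarify
    fix c assume "c \<in> syzygies as"
    then have "cols_mat r as *\<^sub>v vec (length as) c = vec r 0"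
      by (subst cols_mat_mult [where c = c]) (auto simp: syzygies_def)
    also have "\<dots> = 0\<^sub>v r" by auto
    finally show "vec (length as) c \<in> mat_kernel (cols_mat r as)"
      by (simp add: mat_kernel_def)
  qed
qed

lemma graded_map_cols_mat:
  assumes "\<forall>a\<in>set as. vhomog k a"
  shows "graded_map (replicate r e) (replicate (length as) (e + k)) (cols_mat r as)"
proof -
  have "homog k ((as ! j) i)" if "j < length as" for i j
    using assms that by (simp add: vhomog_def)
  then show ?thesis
    by (simp add: graded_map_def cols_mat_def homog_def)
qed

definition embed :: "'a::comm_ring_1 \<Rightarrow> nat \<Rightarrow> 'a" where
  "embed p = (\<lambda>i. if i = 0 then p else 0)"

lemma embed_inj: "embed p = embed q \<longleftrightarrow> p = q"
  by (auto simp: embed_def fun_eq_iff split: if_splits)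

lemma embed_scale: "vscale c (embed p) = embed (c * p)"
  by (simp add: vscale_def embed_def fun_eq_iff)

interpretation embed: module_hom "(*) :: 'a::comm_ring_1 \<Rightarrow> 'a \<Rightarrow> 'a" vscale embed
  by unfold_locales (auto simp: vscale_def embed_def)

lemma lin_quot_embed:
  fixes us :: "'n::finite mon list"
  assumes "\<And>j. 1 \<le> j \<Longrightarrow> j < length us \<Longrightarrow>
      \<exists>X. colon_ideal (monomial_ideal (set (take j us))) (mono_poly (us ! j))
        = (ideal_gen (var_poly ` X) :: ('n, 'k::field) mpol set)"
  shows "lin_quot (map (\<lambda>m. embed (mono_poly m :: ('n, 'k) mpol)) us)"
  using assms
proof (induction us rule: rev_induct)
  case Nil
  then show ?case by (simp add: lin_quot.Nil)
next
  case (snoc u us)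
  let ?e = "\<lambda>m. embed (mono_poly m :: ('n, 'k) mpol)"
  have "\<exists>X. colon_ideal (monomial_ideal (set us)) (mono_poly u)
        = (ideal_gen (var_poly ` X) :: ('n, 'k) mpol set)"
  proof (cases us)
    \<comment> \<open>Linear quotients of an ideal say nothing about the first generator. Its colon
      ideal is that of the zero ideal, generated by no variables.\<close>
    case Nil
    then show ?thesis
      using colon_monomial_ideal_eq_vars [of "{}" "{}" u] by (metis empty_iff empty_set)
  next
    case Cons
    then show ?thesis using snoc.prems [of "length us"] by simp
  qed
  then obtain X where X: "colon_ideal (monomial_ideal (set us)) (mono_poly u)
        = (ideal_gen (var_poly ` X) :: ('n, 'k) mpol set)" ..
  have "vmod.span (set (map ?e us)) = embed ` monomial_ideal (set us)"
    by (simp add: monomial_ideal_def ideal_gen_def embed.span_image [symmetric] image_image)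
  then have "{g. vscale g (?e u) \<in> vmod.span (set (map ?e us))} = ideal_gen (var_poly ` X)"
    unfolding X [symmetric] colon_ideal_def by (auto simp: embed_scale embed_inj image_iff)
  moreover have "lin_quot (map ?e us)"
  proof (rule snoc.IH)
    fix j assume "1 \<le> j" "j < length us"
    then show "\<exists>X. colon_ideal (monomial_ideal (set (take j us))) (mono_poly (us ! j))
        = (ideal_gen (var_poly ` X) :: ('n, 'k) mpol set)"
      using snoc.prems [of j] by (simp add: nth_append)
  qed
  ultimately show ?case
    using lin_quot.snoc [of "map ?e us" "?e u" X] by simp
qed

theorem linear_quotients_imp_linear_resolution:
  fixes us :: "'n::finite mon list"
  assumes deg: "\<And>m. m \<in> set us \<Longrightarrow> mdeg m = d"
    and colon: "\<And>j. 1 \<le> j \<Longrightarrow> j < length us \<Longrightarrow>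
      \<exists>X. colon_ideal (monomial_ideal (set (take j us))) (mono_poly (us ! j))
        = (ideal_gen (var_poly ` X) :: ('n, 'k::field) mpol set)"
  shows "has_linear_resolution d (monomial_ideal (set us) :: ('n, 'k) mpol set)"
proof -
  \<comment> \<open>The generators of the ideal have degree \<open>d\<close>; at every later stage
    the coordinates of the vectors are linear forms.\<close>
  let ?deg = "\<lambda>i. if i = 0 then d else 1"
  let ?as = "map (\<lambda>m. embed (mono_poly m :: ('n, 'k) mpol)) us"
  define P where "P i bs \<longleftrightarrow> (i = 0 \<longrightarrow> bs = ?as) \<and> lin_quot bs \<and> (\<forall>b\<in>set bs. vhomog (?deg i) b)"
    for i :: nat and bs
  have "\<exists>bs. P 0 bs"
    using deg lin_quot_embed [of us, OF colon]
    by (auto simp: P_def vhomog_def embed_def)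
  moreover have "\<exists>bs'. P (Suc i) bs' \<and> vmod.span (set bs') = syzygies bs" if "P i bs" for i bs
    using that lin_quot_syzygies [of bs "?deg i"] by (auto simp: P_def)
  \<comment> \<open>Taking syzygies preserves the invariant and can be repeated forever. No bound on
    the length is needed, since a resolution here is indexed by all natural numbers.\<close>
  ultimately obtain B where B: "\<And>i. P i (B i)"
      "\<And>i. vmod.span (set (B (Suc i))) = syzygies (B i)"
    using dependent_nat_choice [of P "\<lambda>_ bs bs'. vmod.span (set bs') = syzygies bs"] by metis
  have hom: "\<forall>b\<in>set (B i). vhomog (?deg i) b" for i
    using B(1) by (simp add: P_def)
  define r where "r i = (case i of 0 \<Rightarrow> 1 | Suc i' \<Rightarrow> length (B i'))" for i
  define F where "F i = replicate (length (B i)) (d + i)" for i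
  define \<phi> where "\<phi> i = cols_mat (r i) (B i)" for i
  have r_Suc [simp]: "r (Suc i) = length (B i)" and r_0 [simp]: "r 0 = 1" for i
    by (simp_all add: r_def)
  have B_0: "B 0 = ?as" using B(1) [of 0] by (simp add: P_def)
  have "graded_map [0] (F 0) (\<phi> 0)"
    using graded_map_cols_mat [of "B 0" d 1 0] hom [of 0] by (simp add: F_def \<phi>_def)
  moreover have "graded_map (F i) (F (Suc i)) (\<phi> (Suc i))" for i
    using graded_map_cols_mat [of "B (Suc i)" 1 "length (B i)" "d + i"] hom [of "Suc i"]
    by (simp add: F_def \<phi>_def)
  moreover have "mat_image (\<phi> 0) = {vec 1 (\<lambda>_. f) | f. f \<in> monomial_ideal (set us)}"
  proof -
    have "vmod.span (set (B 0)) = embed ` monomial_ideal (set us)"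
      by (simp add: B_0 monomial_ideal_def ideal_gen_def embed.span_image [symmetric] image_image)
    moreover have "vec 1 (embed f) = vec 1 (\<lambda>_. f)" for f :: "('n, 'k) mpol"
      by (intro eq_vecI) (auto simp: embed_def)
    ultimately show ?thesis
      by (auto simp: \<phi>_def mat_image_cols_mat image_image)
  qed
  moreover have "mat_kernel (\<phi> i) = mat_image (\<phi> (Suc i))" for i
    unfolding \<phi>_def mat_image_cols_mat B(2) r_Suc
  proof (rule mat_kernel_cols_mat)
    fix a j assume a: "a \<in> set (B i)" "j \<ge> r i"
    show "a j = 0"
    proof (cases i)
      case 0
      then show ?thesis using a B_0 by (auto simp: embed_def)
    next
      case (Suc i')
      then have "a \<in> syzygies (B i')"
        using a(1) B(2) vmod.span_base by blast
      then show ?thesis using a(2) Suc by (simp add: syzygies_def)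
    qed
  qed
  \<comment> \<open>Minimality comes for free: every entry of a differential is homogeneous of
    degree 1.\<close>
  moreover have "elements_mat (\<phi> (Suc i)) \<subseteq> ideal_gen (range var_poly)" for i
  proof
    fix p assume "p \<in> elements_mat (\<phi> (Suc i))"
    then obtain j k where "k < length (B (Suc i))" "p = (B (Suc i) ! k) j"
      by (auto simp: elements_mat_def \<phi>_def cols_mat_def)
    then have "homog 1 p"
      using hom [of "Suc i"] by (simp add: vhomog_def)
    show "p \<in> ideal_gen (range var_poly)"
      unfolding in_ideal_gen_var_poly
    proof
      fix t assume "t \<in> keys p"
      with \<open>homog 1 p\<close> have "mdeg t = 1" by (simp add: homog_def)
      then have "t \<noteq> 0" by (auto simp: mdeg_def)
      then obtain x where "lkp t x \<noteq> 0" by (metis lookup_zero poly_mapping_eqI)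
      then show "\<exists>x\<in>UNIV. lkp t x > 0" by auto
    qed
  qed
  ultimately have "minimal_graded_free_resolution (monomial_ideal (set us)) F \<phi>"
    unfolding minimal_graded_free_resolution_def by blast
  then show ?thesis
    unfolding has_linear_resolution_def by (intro exI [of _ F] exI [of _ \<phi>]) (simp add: F_def)
qed

section \<open>A necessary condition for a linear resolution\<close>

lemma mdeg_pos_key:
  assumes "mdeg t \<noteq> 0"
  obtains x where "lkp t x > 0"
  using assms unfolding mdeg_eq_0 by (metis gr0I lookup_zero poly_mapping_eqI)

lemma mdeg_1_var_mon:
  assumes "mdeg t = 1"
  obtains x where "t = var_mon x"
proof -
  obtain x where "lkp t x > 0" using mdeg_pos_key assms by (metis zero_neq_one)
  then obtain s where "t = s + var_mon x" by (rule key_addend)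
  with assms that show ?thesis by simp
qed

lemma keys_sum_mult:
  fixes p q :: "'i \<Rightarrow> ('n, 'k::field) mpol"
  assumes "t \<in> keys (\<Sum>j\<in>J. p j * q j)"
  obtains j a b where "j \<in> J" "a \<in> keys (p j)" "b \<in> keys (q j)" "t = a + b"
proof -
  from assms have "(\<Sum>j\<in>J. lkp (p j * q j) t) \<noteq> 0" by (simp add: in_keys_iff lookup_sum)
  then obtain j where "j \<in> J" "t \<in> keys (p j * q j)"
    by (metis (mono_tags, lifting) in_keys_iff sum.neutral)
  then show ?thesis using keys_mult [of "p j" "q j"] that by auto
qed

definition restrict_keys :: "'a set \<Rightarrow> ('a \<Rightarrow>\<^sub>0 'b::comm_monoid_add) \<Rightarrow> 'a \<Rightarrow>\<^sub>0 'b" where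
  "restrict_keys A p = Poly_Mapping.mapp (\<lambda>t c. c when t \<in> A) p"

lemma lookup_restrict_keys: "lkp (restrict_keys A p) t = (if t \<in> A then lkp p t else 0)"
  by (simp add: restrict_keys_def lookup_mapp when_def in_keys_iff)

lemma restrict_keys_add: "restrict_keys A (p + q) = restrict_keys A p + restrict_keys A q"
  by (rule poly_mapping_eqI) (simp add: lookup_restrict_keys lookup_add)

lemma restrict_keys_sum: "restrict_keys A (\<Sum>j\<in>J. p j) = (\<Sum>j\<in>J. restrict_keys A (p j))"
  by (rule poly_mapping_eqI) (simp add: lookup_restrict_keys lookup_sum)

lemma restrict_keys_id: "keys p \<subseteq> A \<Longrightarrow> restrict_keys A p = p"
  by (rule poly_mapping_eqI) (auto simp: lookup_restrict_keys in_keys_iff)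

lemma restrict_keys_0: "keys p \<inter> A = {} \<Longrightarrow> restrict_keys A p = 0"
  by (rule poly_mapping_eqI) (auto simp: lookup_restrict_keys in_keys_iff)

lemma keys_restrict_keys: "keys (restrict_keys A p) = keys p \<inter> A"
  by (auto simp: in_keys_iff lookup_restrict_keys split: if_splits)

text \<open>A factor of degree 0 is a scalar and moves no monomial into or out of \<open>A\<close>.
  For other factors the equation can fail.\<close>

lemma restrict_keys_mult_const:
  fixes c p :: "('n::finite, 'k::field) mpol"
  assumes "homog 0 c"
  shows "restrict_keys A (c * p) = c * restrict_keys A p"
proof -
  have keys: "keys (c * q) \<subseteq> keys q" for q
    using keys_mult [of c q] assms by (fastforce simp: homog_def)
  define r where "r = p - restrict_keys A p"
  have "keys r \<inter> A = {}"
    by (auto simp: r_def in_keys_iff lookup_minus lookup_restrict_keys)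
  then have "restrict_keys A (c * r) = 0"
    using keys [of r] by (intro restrict_keys_0) auto
  moreover have "restrict_keys A (c * restrict_keys A p) = c * restrict_keys A p"
    using keys [of "restrict_keys A p"] by (intro restrict_keys_id) (auto simp: keys_restrict_keys)
  moreover have "c * p = c * restrict_keys A p + c * r"
    by (simp add: r_def algebra_simps)
  ultimately show ?thesis by (simp add: restrict_keys_add)
qed

text \<open>
  Only the linearity of the first syzygies matters: a linear syzygy of the generators of \<open>G \<union> H\<close>,
  with the terms from \<open>H\<close> moved to the other side, is an element of \<open>(G) \<inter> (H)\<close> of degree
  \<open>d + 1\<close>, and these elements generate \<open>(G) \<inter> (H)\<close>.
\<close>

theorem linear_resolution_imp_intersection_generated:
  fixes G H :: "'n::finite mon set"
  assumes res: "has_linear_resolution d (monomial_ideal (G \<union> H) :: ('n, 'k::field) mpol set)"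
    and disj: "G \<inter> H = {}"
    and deg: "\<And>m. m \<in> G \<union> H \<Longrightarrow> mdeg m = d"
    and m: "g \<in> G" "mdvd g z" "h \<in> H" "mdvd h z"
  obtains s t a b where "s \<in> G" "t \<in> H" "s + var_mon a = t + var_mon b" "mdvd (s + var_mon a) z"
proof -
  from res obtain F \<phi> where F: "\<And>i e. e \<in> set (F i) \<Longrightarrow> e = d + i"
    and "minimal_graded_free_resolution (monomial_ideal (G \<union> H) :: ('n, 'k) mpol set) F \<phi>"
    unfolding has_linear_resolution_def by blast
  then have \<phi>_0: "graded_map [0] (F 0) (\<phi> 0)" and \<phi>_1: "graded_map (F 0) (F 1) (\<phi> 1)"
    and image: "mat_image (\<phi> 0)
        = {vec 1 (\<lambda>_. f) | f. f \<in> (monomial_ideal (G \<union> H) :: ('n, 'k) mpol set)}"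
    and exact: "mat_kernel (\<phi> 0) = mat_image (\<phi> 1)"
    unfolding minimal_graded_free_resolution_def by simp_all
  define r where "r = length (F 0)"
  define r' where "r' = length (F 1)"
  define f where "f j = \<phi> 0 $$ (0, j)" for j
  define c where "c j k = \<phi> 1 $$ (j, k)" for j k
  have dim_0: "\<phi> 0 \<in> carrier_mat 1 r" and dim_1: "\<phi> 1 \<in> carrier_mat r r'"
    using \<phi>_0 \<phi>_1 by (simp_all add: graded_map_def r_def r'_def)
  have homog_f: "homog d (f j)" if "j < r" for j
    using \<phi>_0 F [of "F 0 ! j" 0] that by (auto simp: graded_map_def homog_def f_def r_def)
  have homog_c: "homog 1 (c j k)" if "j < r" "k < r'" for j k
    unfolding homog_def
  proof
    fix t assume "t \<in> keys (c j k)"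
    then have "mdeg t + F 0 ! j = F 1 ! k"
      using \<phi>_1 that unfolding graded_map_def c_def r_def r'_def by blast
    moreover have "F 0 ! j = d" "F 1 ! k = d + 1"
      using F [of "F 0 ! j" 0] F [of "F 1 ! k" 1] that by (auto simp: r_def r'_def)
    ultimately show "mdeg t = 1" by simp
  qed
  have mult_0: "\<phi> 0 *\<^sub>v x = vec 1 (\<lambda>_. \<Sum>j<r. x $ j * f j)" if "x \<in> carrier_vec r" for x
    using dim_0 that
    by (intro eq_vecI) (auto simp: scalar_prod_def f_def lessThan_atLeast0 mult.commute intro!: sum.cong)
  have mult_1: "(\<phi> 1 *\<^sub>v y) $ j = (\<Sum>k<r'. c j k * y $ k)"
    if "y \<in> carrier_vec r'" "j < r" for y j
    using dim_1 that by (auto simp: scalar_prod_def c_def lessThan_atLeast0 intro!: sum.cong)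
  have const: "vec 1 (\<lambda>_. p) = vec 1 (\<lambda>_. q) \<longleftrightarrow> p = q" for p q :: "('n, 'k) mpol"
    by (auto dest!: arg_cong [where f = "\<lambda>v. v $ 0"])
  \<comment> \<open>A monomial of degree \<open>d\<close> in an ideal generated in degree
    \<open>d\<close> is itself a generator.\<close>
  have "keys (f j) \<subseteq> G \<union> H" if "j < r" for j
  proof
    fix t assume t: "t \<in> keys (f j)"
    have "(\<Sum>i<r. unit_vec r j $ i * f i) = (\<Sum>i<r. if i = j then f j else 0)"
      using that by (intro sum.cong) auto
    then have "\<phi> 0 *\<^sub>v unit_vec r j = vec 1 (\<lambda>_. f j)"
      using that by (subst mult_0) auto
    then have "vec 1 (\<lambda>_. f j) \<in> mat_image (\<phi> 0)"
      using dim_0 unfolding mat_image_def by (metis (mono_tags, lifting) CollectI carrier_matD(2) unit_vec_carrier)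
    then have "f j \<in> monomial_ideal (G \<union> H)"
      unfolding image mem_Collect_eq const by blast
    then obtain m where "m \<in> G \<union> H" "mdvd m t"
      using t unfolding monomial_ideal_iff by blast
    then show "t \<in> G \<union> H"
      using mdvd_mdeg_eq deg homog_f [OF that] t unfolding homog_def by metis
  qed
  \<comment> \<open>The images of the basis need not be monomials, so each is split into its part on
    \<open>G\<close> and its part on \<open>H\<close>.\<close>
  define f1 where "f1 j = restrict_keys G (f j)" for j
  define f2 where "f2 j = f j - f1 j" for j
  have f1: "keys (f1 j) \<subseteq> G" for j
    by (simp add: f1_def keys_restrict_keys)
  have f2: "keys (f2 j) \<subseteq> H" if "j < r" for j
    using \<open>\<And>j. j < r \<Longrightarrow> keys (f j) \<subseteq> G \<union> H\<close> [OF that] disj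
    by (force simp: f2_def f1_def in_keys_iff lookup_minus lookup_restrict_keys split: if_splits)
  \<comment> \<open>Comparing parts of degree \<open>d\<close> leaves only the constant terms of the
    coefficients: each generator is a scalar combination of the \<open>f j\<close>.\<close>
  have ex: "\<exists>e. (\<forall>j. homog 0 (e j)) \<and> mono_poly m = (\<Sum>j<r. e j * f j)" if "m \<in> G \<union> H" for m
  proof -
    have "mono_poly m \<in> (monomial_ideal (G \<union> H) :: ('n, 'k) mpol set)"
      using that mdvd_refl unfolding mono_poly_in_monomial_ideal by blast
    then have "vec 1 (\<lambda>_. mono_poly m) \<in> mat_image (\<phi> 0)"
      unfolding image by blast
    then obtain x where x: "x \<in> carrier_vec r" "vec 1 (\<lambda>_. mono_poly m) = \<phi> 0 *\<^sub>v x"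
      using dim_0 unfolding mat_image_def by auto
    have "mono_poly m = (\<Sum>j<r. x $ j * f j)"
      using x(2) unfolding mult_0 [OF x(1)] const .
    then have "hcomp (0 + d) (mono_poly m) = (\<Sum>j<r. hcomp (0 + d) (x $ j * f j))"
      by (simp add: hcomp_sum)
    also have "\<dots> = (\<Sum>j<r. hcomp 0 (x $ j) * f j)"
      by (intro sum.cong refl hcomp_mult_homog homog_f) simp
    finally have "mono_poly m = (\<Sum>j<r. hcomp 0 (x $ j) * f j)"
      using deg [OF that] by (simp add: hcomp_homog)
    then show ?thesis
      by (intro exI [of _ "\<lambda>j. hcomp 0 (x $ j)"]) simp
  qed
  obtain e where e: "\<And>j. homog 0 (e j)" "mono_poly g = (\<Sum>j<r. e j * f j)"
    using ex [of g] m by blast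
  obtain e' where e': "\<And>j. homog 0 (e' j)" "mono_poly h = (\<Sum>j<r. e' j * f j)"
    using ex [of h] m by blast
  have e1: "(\<Sum>j<r. e j * f1 j) = mono_poly g"
  proof -
    have "(\<Sum>j<r. e j * f1 j) = restrict_keys G (mono_poly g)"
      by (simp add: e restrict_keys_sum restrict_keys_mult_const f1_def)
    then show ?thesis using m by (simp add: restrict_keys_id)
  qed
  have e'1: "(\<Sum>j<r. e' j * f1 j) = 0"
  proof -
    have "(\<Sum>j<r. e' j * f1 j) = restrict_keys G (mono_poly h)"
      by (simp add: e' restrict_keys_sum restrict_keys_mult_const f1_def)
    then show ?thesis using m disj by (subst (asm) restrict_keys_0) auto
  qed
  obtain p where p: "z = p + g" using m(2) by (auto simp: mdvd_iff add.commute)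
  obtain q where q: "z = q + h" using m(4) by (auto simp: mdvd_iff add.commute)
  \<comment> \<open>The relation \<open>(z/g) g - (z/h) h = 0\<close>, written in terms of the basis
    of the first module.\<close>
  define w where "w j = mono_poly p * e j - mono_poly q * e' j" for j
  have w: "(\<Sum>j<r. w j * l j)
      = mono_poly p * (\<Sum>j<r. e j * l j) - mono_poly q * (\<Sum>j<r. e' j * l j)" for l
    by (simp add: w_def left_diff_distrib sum_subtractf sum_distrib_left mult.assoc)
  have "(\<Sum>j<r. w j * f j) = 0"
    unfolding w e(2) [symmetric] e'(2) [symmetric] mono_poly_add [symmetric] p [symmetric]
      q [symmetric] by simp
  then have "\<phi> 0 *\<^sub>v vec r w = 0\<^sub>v 1"
    by (subst mult_0) auto
  then have "vec r w \<in> mat_image (\<phi> 1)"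
    unfolding exact [symmetric] mat_kernel_def using dim_0 by simp
  then obtain y where y: "y \<in> carrier_vec r'" "vec r w = \<phi> 1 *\<^sub>v y"
    using dim_1 unfolding mat_image_def by auto
  have w_y: "w j = (\<Sum>k<r'. c j k * y $ k)" if "j < r" for j
    using mult_1 [OF y(1) that] y(2) that by (metis index_vec)
  \<comment> \<open>The part on \<open>G\<close> of the \<open>k\<close>-th linear syzygy. As the
    syzygy vanishes, it is also the negative of the part on \<open>H\<close>, so its monomials of
    degree \<open>d + 1\<close> are multiples of both a member of \<open>G\<close> and one of
    \<open>H\<close>.\<close>
  define P where "P k = (\<Sum>j<r. c j k * f1 j)" for k
  have syz: "(\<Sum>j<r. c j k * f j) = 0" if "k < r'" for k
  proof -
    have col: "col (\<phi> 1) k = \<phi> 1 *\<^sub>v unit_vec r' k"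
      using dim_1 that by (auto intro!: eq_vecI simp: scalar_prod_right_unit)
    have "col (\<phi> 1) k \<in> mat_kernel (\<phi> 0)"
      unfolding exact mat_image_def using dim_1 col by auto
    then have ker: "\<phi> 0 *\<^sub>v col (\<phi> 1) k = 0\<^sub>v 1"
      using dim_0 by (simp add: mat_kernel_def)
    have "vec 1 (\<lambda>_. \<Sum>j<r. c j k * f j) = \<phi> 0 *\<^sub>v col (\<phi> 1) k"
      using dim_1 that by (subst mult_0) (auto simp: c_def intro!: sum.cong eq_vecI)
    also have "\<dots> = vec 1 (\<lambda>_. 0)" unfolding ker by (auto intro: eq_vecI)
    finally have "vec 1 (\<lambda>_. \<Sum>j<r. c j k * f j) = vec 1 (\<lambda>_. 0)" .
    then show ?thesis unfolding const .
  qed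
  have P': "P k = - (\<Sum>j<r. c j k * f2 j)" if "k < r'" for k
    using syz [OF that] by (simp add: P_def f2_def right_diff_distrib sum_subtractf)
  \<comment> \<open>Projecting the relation \<open>w\<close> to \<open>G\<close> kills the summand
    of \<open>h\<close> and keeps \<open>(z/g) g = z\<close>. Expanding \<open>w\<close> in linear
    syzygies shows that \<open>z\<close> is a multiple of a monomial of some
    \<open>P k\<close>.\<close>
  have "mono_poly z = (\<Sum>j<r. w j * f1 j)"
    unfolding w e1 e'1 by (simp add: p mono_poly_add)
  also have "\<dots> = (\<Sum>j<r. \<Sum>k<r'. c j k * y $ k * f1 j)"
    by (intro sum.cong refl) (simp add: w_y sum_distrib_right)
  also have "\<dots> = (\<Sum>k<r'. \<Sum>j<r. c j k * y $ k * f1 j)"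
    by (rule sum.swap)
  also have "\<dots> = (\<Sum>k<r'. y $ k * P k)"
    unfolding P_def sum_distrib_left by (intro sum.cong refl) (simp add: ac_simps)
  finally have "z \<in> keys (\<Sum>k<r'. y $ k * P k)"
    by (metis keys_mono_poly singletonI)
  then obtain k z0 u where "k \<in> {..<r'}" and k: "u \<in> keys (P k)" "z = z0 + u"
    by (rule keys_sum_mult)
  then have k_less: "k < r'" by simp
  from k(1) obtain j a s where s: "j < r" "a \<in> keys (c j k)" "s \<in> keys (f1 j)" "u = a + s"
    unfolding P_def by (auto elim!: keys_sum_mult)
  have "u \<in> keys (\<Sum>j<r. c j k * f2 j)"
    using k(1) by (simp add: P' [OF k_less] in_keys_iff)
  then obtain i b t where t: "i < r" "b \<in> keys (c i k)" "t \<in> keys (f2 i)" "u = b + t"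
    by (auto elim!: keys_sum_mult)
  have "mdeg a = 1" "mdeg b = 1"
    using homog_c k_less s t by (auto simp: homog_def)
  then obtain x x' where "a = var_mon x" "b = var_mon x'"
    using mdeg_1_var_mon by metis
  then have "s + var_mon x = t + var_mon x'" "mdvd (s + var_mon x) z"
    using s(4) t(4) k(2) mdvd_iff by (metis add.commute)+
  moreover have "s \<in> G" "t \<in> H"
    using f1 f2 s t by blast+
  ultimately show ?thesis using that by blast
qed

section \<open>The lexicographic order\<close>

lemma less_mon_iff:
  fixes s t :: "'n::linorder mon"
  shows "s < t \<longleftrightarrow> (\<exists>k. lkp s k < lkp t k \<and> (\<forall>j<k. lkp s j = lkp t j))"
  by (simp add: less_poly_mapping.rep_eq less_fun_def)

lemma first_le [simp]: "Min UNIV \<le> (i :: 'n::{finite,linorder})"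
  by (rule Min_le [OF finite_UNIV UNIV_I])

lemma le_last [simp]: "i \<le> (Max UNIV :: 'n::{finite,linorder})"
  by (rule Max_ge [OF finite_UNIV UNIV_I])

lemma not_less_first [simp]: "\<not> i < (Min UNIV :: 'n::{finite,linorder})"
  using first_le leD by blast

lemma less_if_first_less:
  fixes s t :: "'n::{finite,linorder} mon"
  assumes "lkp s (Min UNIV) < lkp t (Min UNIV)"
  shows "s < t"
  using assms unfolding less_mon_iff by (intro exI [of _ "Min UNIV"]) simp

lemma first_mono:
  fixes s t :: "'n::{finite,linorder} mon"
  assumes "s \<le> t"
  shows "lkp s (Min UNIV) \<le> lkp t (Min UNIV)"
  using assms less_if_first_less by (meson leD not_le)

lemma var_mon_less: "i < j \<Longrightarrow> var_mon j < (var_mon i :: 'n::linorder mon)"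
  unfolding less_mon_iff by (intro exI [of _ i]) (auto simp: lookup_var_mon)

lemma var_mon_less_iff [simp]: "var_mon j < (var_mon i :: 'n::linorder mon) \<longleftrightarrow> i < j"
  using var_mon_less by (metis not_less_iff_gr_or_eq)

lemma var_mon_le_iff [simp]: "var_mon j \<le> (var_mon i :: 'n::linorder mon) \<longleftrightarrow> i \<le> j"
  by (simp flip: not_less)

text \<open>Up to the first difference \<open>l\<close> both monomials have the same variables, and
  \<open>l\<close> itself occurs in \<open>t\<close>. Hence every variable of \<open>s\<close>
  occurs in \<open>t\<close> or lies at or after one that does.\<close>

lemma keys_up_mono:
  fixes s t :: "'n::linorder mon"
  assumes "s \<le> t" "\<And>k. lkp t k > 0 \<Longrightarrow> Q k" "\<And>i j. Q i \<Longrightarrow> i \<le> j \<Longrightarrow> Q j" "lkp s k > 0"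
  shows "Q k"
proof (cases "s = t")
  case True
  then show ?thesis using assms by simp
next
  case False
  then obtain l where l: "lkp s l < lkp t l" "\<And>j. j < l \<Longrightarrow> lkp s j = lkp t j"
    using assms(1) unfolding less_le less_mon_iff by (metis less_le less_mon_iff)
  show ?thesis
  proof (cases "k < l")
    case True
    then show ?thesis using l(2) assms(2,4) by metis
  next
    case False
    then show ?thesis using l(1) assms(2,3) by (metis gr0I less_zeroE not_less)
  qed
qed

lemma keys_ge_mono:
  fixes s t :: "'n::linorder mon"
  assumes "s \<le> t" "\<And>k. lkp t k > 0 \<Longrightarrow> l \<le> k" "lkp s k > 0"
  shows "l \<le> k"
  by (rule keys_up_mono [of s t "\<lambda>k. l \<le> k", OF assms(1) _ _ assms(3)]) (erule assms(2), rule order_trans)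

lemma keys_gt_mono:
  fixes s t :: "'n::linorder mon"
  assumes "s \<le> t" "\<And>k. lkp t k > 0 \<Longrightarrow> l < k" "lkp s k > 0"
  shows "l < k"
  by (rule keys_up_mono [of s t "\<lambda>k. l < k", OF assms(1) _ _ assms(3)]) (erule assms(2), rule less_le_trans)

lemma mdeg_mono: "mdvd s t \<Longrightarrow> mdeg s \<le> mdeg t"
  unfolding mdeg_def mdvd_def by (rule sum_mono) simp

lemma mdeg_single [simp]: "mdeg (Poly_Mapping.single i a) = a"
  by (simp add: mdeg_def lookup_single when_def)

lemma eq_single_if_keys:
  assumes "\<And>k. lkp t k > 0 \<Longrightarrow> k = i"
  shows "t = Poly_Mapping.single i (mdeg t)"
proof -
  have "t = Poly_Mapping.single i (lkp t i)"
    using assms by (intro poly_mapping_eqI) (auto simp: lookup_single when_def)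
  then show ?thesis by (metis mdeg_single)
qed

lemma single_last_le:
  fixes t :: "'n::{finite,linorder} mon"
  shows "Poly_Mapping.single (Max UNIV) (mdeg t) \<le> t"
proof (rule ccontr)
  assume "\<not> ?thesis"
  then have less: "t < Poly_Mapping.single (Max UNIV) (mdeg t)" by simp
  have "t = Poly_Mapping.single (Max UNIV) (mdeg t)"
  proof (rule eq_single_if_keys)
    fix k assume "lkp t k > 0"
    have "Max UNIV \<le> k"
    proof (rule keys_ge_mono [OF less_imp_le [OF less] _ \<open>lkp t k > 0\<close>])
      show "Max UNIV \<le> k" if "lkp (Poly_Mapping.single (Max UNIV) (mdeg t)) k > 0" for k
        using that by (simp add: lookup_single when_def split: if_splits)
    qed
    then show "k = Max UNIV" by (simp add: antisym)
  qed
  with less show False by simp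
qed

lemma le_single:
  fixes t :: "'n::{finite,linorder} mon"
  assumes "\<And>k. lkp t k > 0 \<Longrightarrow> l \<le> k"
  shows "t \<le> Poly_Mapping.single l (mdeg t)"
proof (rule ccontr)
  assume "\<not> ?thesis"
  then obtain k where k: "lkp (Poly_Mapping.single l (mdeg t)) k < lkp t k"
      "\<And>j. j < k \<Longrightarrow> lkp (Poly_Mapping.single l (mdeg t)) j = lkp t j"
    by (auto simp: not_le less_mon_iff)
  have "l \<le> k" using assms k(1) by fastforce
  show False
  proof (cases "k = l")
    case True
    have "mdvd (Poly_Mapping.single l (lkp t l)) t"
      by (simp add: mdvd_def lookup_single when_def)
    then have "lkp t l \<le> mdeg t" using mdeg_mono by fastforce
    with k(1) True show False by simp
  next
    case False
    then have "lkp t l = mdeg t" using k(2) [of l] \<open>l \<le> k\<close> by simp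
    then have "mdvd (Poly_Mapping.single l (mdeg t) + var_mon k) t"
      using k(1) False by (auto simp: mdvd_def lookup_single lookup_add when_def lookup_var_mon)
    then show False using mdeg_mono by fastforce
  qed
qed

section \<open>Completely lexsegments\<close>

lemma in_lexsegment: "w \<in> lexsegment d u v \<longleftrightarrow> mdeg w = d \<and> v \<le> w \<and> w \<le> u"
  by (simp add: lexsegment_def monomials_def)

text \<open>A first difference before \<open>i\<close> would survive the multiplication by the two
  variables. One at or after \<open>i\<close> would make \<open>m\<close> a proper divisor of
  \<open>v\<close>, against equal degrees. This serves to divide a monomial by its last
  variable.\<close>

lemma le_div_last_key:
  fixes m v :: "'n::{finite,linorder} mon"
  assumes deg: "mdeg m = mdeg v"
    and le: "v + var_mon (Max UNIV) \<le> m + var_mon i"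
    and last: "\<And>k. lkp m k > 0 \<Longrightarrow> k \<le> i"
  shows "v \<le> m"
proof (rule ccontr)
  assume "\<not> v \<le> m"
  then obtain k where k: "lkp m k < lkp v k" "\<And>j. j < k \<Longrightarrow> lkp m j = lkp v j"
    by (auto simp: not_le less_mon_iff)
  show False
  proof (cases "k < i")
    case True
    then have "m + var_mon i < v + var_mon (Max UNIV)"
      unfolding less_mon_iff using k
      by (intro exI [of _ k]) (auto simp: lookup_add lookup_var_mon dest: leD)
    with le show False by simp
  next
    case False
    have "mdvd m v"
      unfolding mdvd_def
    proof
      fix j show "lkp m j \<le> lkp v j"
        using k(1) k(2) [of j] last [of j] False by - (cases "lkp m j = 0"; rule linorder_cases [of j k]; force)
    qed
    with deg k(1) show False
      using mdvd_mdeg_eq by fastforce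
  qed
qed

text \<open>
  Between the endpoints, only monomials \<open>x\<^sub>1 w\<close> with \<open>w < v\<close> not divisible by \<open>x\<^sub>1\<close> can be missing from
  the shadow; the last hypothesis puts them there. It holds trivially once \<open>x\<^sub>1\<^sup>2\<close> divides \<open>u\<close>,
  hence it persists under the shadow.
\<close>

lemma shadow_lexsegment:
  fixes u v :: "'n::{finite,linorder} mon"
  assumes deg: "mdeg u = d" "mdeg v = d"
    and first: "lkp u (Min UNIV) > 0" "lkp v (Min UNIV) = 0"
    and cond: "\<And>w. mdeg w = d \<Longrightarrow> w < v \<Longrightarrow>
      \<exists>i. lkp w i > 0 \<and> w + var_mon (Min UNIV) \<le> u + var_mon i"
  shows "shadow (lexsegment d u v)
    = lexsegment (Suc d) (u + var_mon (Min UNIV)) (v + var_mon (Max UNIV))"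
    (is "?S = ?L")
proof
  show "?S \<subseteq> ?L"
    by (auto simp: shadow_def in_lexsegment intro!: add_mono)
  show "?L \<subseteq> ?S"
  proof
    fix z assume "z \<in> ?L"
    then have z: "mdeg z = Suc d" "v + var_mon (Max UNIV) \<le> z" "z \<le> u + var_mon (Min UNIV)"
      by (simp_all add: in_lexsegment)
    have shadowI: "z \<in> ?S" if "z = m + var_mon i" "v \<le> m" "m \<le> u" for m i
      using that z(1) unfolding shadow_def in_lexsegment by auto
    \<comment> \<open>The exponent of \<open>x_1\<close> decides which variable to remove. With 0 it
      is the last one, and the result is below \<open>u\<close> in any case; with at least 2 it is
      \<open>x_1\<close>, and the result is still above \<open>v\<close>. Only exponent 1 may need
      the hypothesis \<open>cond\<close>.\<close>
    consider "lkp z (Min UNIV) = 0" | "lkp z (Min UNIV) = 1" | "lkp z (Min UNIV) \<ge> 2"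
      by linarith
    then show "z \<in> ?S"
    proof cases
      case 1
      define i where "i = Max {k. lkp z k > 0}"
      obtain k where "lkp z k > 0" using mdeg_pos_key z(1) by (metis nat.distinct(1))
      then have "lkp z i > 0"
        using Max_in [of "{k. lkp z k > 0}"] unfolding i_def by auto
      then obtain m where m: "z = m + var_mon i" by (rule key_addend)
      have "v \<le> m"
      proof (rule le_div_last_key)
        show "mdeg m = mdeg v" using z(1) m deg by simp
        show "v + var_mon (Max UNIV) \<le> m + var_mon i" using z(2) m by simp
        show "k \<le> i" if "lkp m k > 0" for k
          unfolding i_def using that m by (intro Max_ge) (auto simp: lookup_add)
      qed
      moreover have "m < u"
        using 1 m first(1) by (intro less_if_first_less) (simp add: lookup_add)
      ultimately show ?thesis using shadowI m by simp
    next
      case 2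
      then have "lkp z (Min UNIV) > 0" by simp
      then obtain w where w: "z = w + var_mon (Min UNIV)" by (rule key_addend)
      have w_first: "lkp w (Min UNIV) = 0" using 2 w by (simp add: lookup_add lookup_var_mon)
      show ?thesis
      proof (cases "v \<le> w")
        case True
        have "w < u" using w_first first(1) by (intro less_if_first_less) simp
        then show ?thesis using shadowI w True by simp
      next
        case False
        then obtain i where i: "lkp w i > 0" "w + var_mon (Min UNIV) \<le> u + var_mon i"
          using cond [of w] z(1) w False by (auto simp: not_le)
        from i(1) obtain s where s: "w = s + var_mon i" by (rule key_addend)
        have "(s + var_mon (Min UNIV)) + var_mon i \<le> u + var_mon i"
          using i(2) unfolding s by (simp only: ac_simps)
        then have "s + var_mon (Min UNIV) \<le> u" by simp
        moreover have "v < s + var_mon (Min UNIV)"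
          using first(2) by (intro less_if_first_less) (simp add: lookup_add lookup_var_mon)
        moreover have "z = s + var_mon (Min UNIV) + var_mon i"
          using w s by (simp add: ac_simps)
        ultimately show ?thesis using shadowI by simp
      qed
    next
      case 3
      then have "lkp z (Min UNIV) > 0" by simp
      then obtain m where m: "z = m + var_mon (Min UNIV)" by (rule key_addend)
      have "v < m"
        using 3 m first(2) by (intro less_if_first_less) (simp add: lookup_add lookup_var_mon)
      moreover have "m \<le> u" using z(3) m by simp
      ultimately show ?thesis using shadowI m by simp
    qed
  qed
qed

lemma completely_lexsegment_if:
  fixes u v :: "'n::{finite,linorder} mon"
  assumes "mdeg u = d" "mdeg v = d"
    and "lkp u (Min UNIV) > 0" "lkp v (Min UNIV) = 0"
    and "\<And>w. mdeg w = d \<Longrightarrow> w < v \<Longrightarrow>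
      \<exists>i. lkp w i > 0 \<and> w + var_mon (Min UNIV) \<le> u + var_mon i"
  shows "is_lexsegment ((shadow ^^ k) (lexsegment d u v))"
  using assms
proof (induction k arbitrary: d u v)
  case 0
  then have "v \<le> u" using less_if_first_less [of v u] by simp
  then show ?case
    using 0 unfolding is_lexsegment_def monomials_def by auto
next
  case (Suc k)
  let ?u = "u + var_mon (Min UNIV)" and ?v = "v + var_mon (Max UNIV)"
  \<comment> \<open>With a single variable \<open>u\<close> and \<open>v\<close> would coincide.
    Since \<open>x_n\<close> differs from \<open>x_1\<close>, the new lower endpoint is again free
    of \<open>x_1\<close>.\<close>
  have "Min UNIV \<noteq> (Max UNIV :: 'n)"
  proof
    assume "Min UNIV = (Max UNIV :: 'n)"
    then have "i = (Min UNIV :: 'n)" for i using first_le [of i] le_last [of i] by (metis antisym)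
    then have "u = v"
      using Suc.prems eq_single_if_keys by metis
    with Suc.prems show False by simp
  qed
  then have first: "lkp ?v (Min UNIV) = 0"
    using Suc.prems by (simp add: lookup_add lookup_var_mon)
  have "is_lexsegment ((shadow ^^ k) (lexsegment (Suc d) ?u ?v))"
  proof (rule Suc.IH)
    fix w assume w: "mdeg w = Suc d" "w < ?v"
    then have "lkp w (Min UNIV) = 0" using first first_mono [of w ?v] by simp
    then have "w + var_mon (Min UNIV) < ?u + var_mon i" for i
      using Suc.prems by (intro less_if_first_less) (simp add: lookup_add lookup_var_mon)
    moreover obtain i where "lkp w i > 0" using mdeg_pos_key w(1) by (metis nat.distinct(1))
    ultimately show "\<exists>i. lkp w i > 0 \<and> w + var_mon (Min UNIV) \<le> ?u + var_mon i"
      using less_imp_le by blast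
  qed (use Suc.prems first in \<open>simp_all add: lookup_add\<close>)
  then show ?case
    using shadow_lexsegment [OF Suc.prems] by (simp add: funpow_Suc_right del: funpow.simps)
qed

text \<open>The monomial \<open>x_1 w\<close> is missing from the first shadow: its quotient by
  \<open>x_1\<close> is below \<open>v\<close>, and its quotients by the variables of
  \<open>w\<close> are above \<open>u\<close>.\<close>

lemma not_completely_lexsegment_witness:
  fixes u v :: "'n::{finite,linorder} mon"
  assumes "\<not> completely_lexsegment (lexsegment d u v)"
    and "mdeg u = d" "mdeg v = d" "lkp u (Min UNIV) > 0" "lkp v (Min UNIV) = 0"
  obtains w where "mdeg w = d" "w < v" "\<And>i. lkp w i > 0 \<Longrightarrow> u + var_mon i < w + var_mon (Min UNIV)"
  using assms completely_lexsegment_if [of u d v] unfolding completely_lexsegment_def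
  by (metis not_le)

section \<open>The shape of the endpoints\<close>

lemma ex_lcm: "\<exists>z. mdvd s z \<and> mdvd t z \<and> (\<forall>k. lkp z k > 0 \<longrightarrow> lkp s k > 0 \<or> lkp t k > 0)"
  by (intro exI [of _ "s + (t - s)"]) (auto simp: mdvd_def lookup_add lookup_minus)

text \<open>
  Write \<open>u = x\<^sub>1 u'\<close> and \<open>v = x\<^sub>l v'\<close>, where \<open>x\<^sub>l\<close> is the first variable in \<open>v\<close>. The pair \<open>(u, v)\<close>
  gives \<open>v' \<le> u'\<close>, so that \<open>w\<close>, and with it \<open>u'\<close>, involves only variables after \<open>x\<^sub>l\<close>. Then the pair
  \<open>(x\<^sub>1 x\<^sub>n\<^sup>d\<^sup>-\<^sup>1, x\<^sub>l\<^sup>d)\<close> gives \<open>v' = x\<^sub>n\<^sup>d\<^sup>-\<^sup>1\<close>.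
\<close>

lemma endpoints_shape:
  fixes u v w :: "'n::{finite,linorder} mon"
  assumes deg: "mdeg u = d" "mdeg v = d" "mdeg w = d" "d > 0"
    and first: "lkp u (Min UNIV) > 0" "lkp v (Min UNIV) = 0"
    and w: "w < v" "\<And>i. lkp w i > 0 \<Longrightarrow> u + var_mon i < w + var_mon (Min UNIV)"
    and G: "G = {m \<in> lexsegment d u v. lkp m (Min UNIV) > 0}"
    and H: "H = {m \<in> lexsegment d u v. lkp m (Min UNIV) = 0}"
    and inter: "\<And>g h z. g \<in> G \<Longrightarrow> h \<in> H \<Longrightarrow> mdvd g z \<Longrightarrow> mdvd h z \<Longrightarrow>
      \<exists>s\<in>G. \<exists>t\<in>H. \<exists>a b. s + var_mon a = t + var_mon b \<and> mdvd (s + var_mon a) z"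
  obtains l u' where "Min UNIV < l" "u = u' + var_mon (Min UNIV)"
    "v = Poly_Mapping.single (Max UNIV) (d - 1) + var_mon l" "\<And>k. lkp u' k > 0 \<Longrightarrow> l < k"
proof -
  let ?x = "Min UNIV :: 'n"
  obtain u' where u': "u = u' + var_mon ?x" using first(1) by (rule key_addend)
  have w_first: "lkp w ?x = 0" using first_mono [of w v] w(1) first(2) by simp
  obtain i where i: "lkp w i > 0" using mdeg_pos_key deg by (metis not_gr_zero)
  \<comment> \<open>Since \<open>w\<close> is free of \<open>x_1\<close> and
    \<open>u x_i < x_1 w\<close>, the variable \<open>x_1\<close> divides \<open>u\<close> only
    once.\<close>
  have "lkp (u + var_mon i) ?x \<le> lkp (w + var_mon ?x) ?x"
    using w(2) [OF i] by (intro first_mono) simp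
  then have u'_first: "lkp u' ?x = 0"
    using w_first by (simp add: u' lookup_add lookup_var_mon)
  have w_u': "u' + var_mon j < w" if "lkp w j > 0" for j
  proof -
    have "(u' + var_mon j) + var_mon ?x < w + var_mon ?x"
      using w(2) [OF that] unfolding u' by (simp only: ac_simps)
    then show ?thesis by simp
  qed
  define l where "l = Min {k. lkp v k > 0}"
  obtain k where "lkp v k > 0" using mdeg_pos_key deg by (metis not_gr_zero)
  then have v_l: "lkp v l > 0"
    using Min_in [of "{k. lkp v k > 0}"] unfolding l_def by auto
  from v_l obtain v' where v': "v = v' + var_mon l" by (rule key_addend)
  have l_le: "l \<le> k" if "lkp v k > 0" for k
    unfolding l_def using that by (intro Min_le) auto
  have l_first: "?x < l" using \<open>lkp v l > 0\<close> first(2) by (metis first_le less_irrefl order_le_less)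
  have deg': "mdeg u' = d - 1" "mdeg v' = d - 1" using deg u' v' by auto
  have u_G: "u \<in> G" and v_H: "v \<in> H"
    using first deg less_if_first_less [of v u] by (simp_all add: G H in_lexsegment)
  \<comment> \<open>In \<open>s x_a = t x_b\<close> only \<open>s\<close> is divisible by
    \<open>x_1\<close>, so \<open>x_b = x_1\<close>. Thus \<open>s = x_1 q\<close> and
    \<open>t = q x_a\<close> for one \<open>q\<close>, which meets the upper bound through
    \<open>s\<close> and the lower one through \<open>t\<close>.\<close>
  have inter': "\<exists>q a. a \<noteq> ?x \<and> q \<le> u' \<and> v \<le> q + var_mon a \<and> mdeg q = d - 1 \<and> mdvd (q + var_mon a) z"
    if gh: "g \<in> G" "h \<in> H" "mdvd g z" "mdvd h z" for g h z
  proof -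
    obtain s t a b where s: "s \<in> G" "t \<in> H" "s + var_mon a = t + var_mon b" "mdvd (s + var_mon a) z"
      using inter [OF gh] by blast
    have first_st: "lkp s ?x > 0" "lkp t ?x = 0" using s by (simp_all add: G H)
    have "lkp (s + var_mon a) ?x = lkp (t + var_mon b) ?x" using s(3) by simp
    then have ab: "b = ?x" "a \<noteq> ?x"
      using first_st by (auto simp: lookup_add lookup_var_mon split: if_splits)
    obtain q where q: "s = q + var_mon ?x" using first_st(1) by (rule key_addend)
    then have t: "q + var_mon a = t"
      using s(3) ab by (metis add.assoc add.commute add_right_cancel)
    have "q \<le> u'" "mdeg q = d - 1"
      using s(1) by (auto simp: G in_lexsegment u' q)
    moreover have "v \<le> q + var_mon a" using s(2) t by (simp add: H in_lexsegment)
    moreover have "mdvd (q + var_mon a) (s + var_mon a)"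
      by (simp add: q mdvd_def lookup_add)
    then have "mdvd (q + var_mon a) z" using s(4) mdvd_trans by blast
    ultimately show ?thesis using ab by blast
  qed
  have v'_le_u': "v' \<le> u'"
  proof (rule ccontr)
    assume "\<not> v' \<le> u'"
    then have less: "u' < v'" by simp
    obtain z where z: "mdvd u z" "mdvd v z" "\<And>k. lkp z k > 0 \<Longrightarrow> lkp u k > 0 \<or> lkp v k > 0"
      using ex_lcm [of u v] by blast
    obtain q a where q: "a \<noteq> ?x" "q \<le> u'" "v \<le> q + var_mon a" "mdvd (q + var_mon a) z"
      using inter' [OF u_G v_H z(1,2)] by blast
    \<comment> \<open>The chain is \<open>v' x_l \<le> q x_a \<le> u' x_a < v' x_a\<close>. So
      \<open>x_a\<close> comes before all variables of \<open>v\<close> and must occur in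
      \<open>u'\<close>; but \<open>u' < v'\<close> confines \<open>u'\<close> to the variables from
      \<open>x_l\<close> on.\<close>
    have "v' + var_mon l < v' + var_mon a"
      using q(2,3) less unfolding v' by (metis add_strict_right_mono le_less_trans)
    then have "a < l" by simp
    have "lkp z a > 0"
      using q(4) by (auto simp: mdvd_def lookup_add lookup_var_mon dest!: spec [of _ a])
    then have "lkp u' a > 0"
      using z(3) [of a] l_le [of a] \<open>a < l\<close> q(1)
      by (auto simp: u' lookup_add lookup_var_mon split: if_splits)
    moreover have "l \<le> k" if "lkp v' k > 0" for k
      using l_le [of k] that by (simp add: v' lookup_add)
    ultimately have "l \<le> a"
      using keys_ge_mono [OF less_imp_le [OF less]] by blast
    with \<open>a < l\<close> show False by simp
  qed
  have w_keys: "l < k" if "lkp w k > 0" for k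
  proof -
    have "l \<le> k"
      using keys_ge_mono [OF less_imp_le [OF w(1)] l_le that] .
    \<comment> \<open>If \<open>x_l\<close> divided \<open>w\<close>, then
      \<open>u' x_l < w < v = v' x_l\<close>, against \<open>v' \<le> u'\<close>.\<close>
    moreover have "k \<noteq> l"
    proof
      assume "k = l"
      then have "u' + var_mon l < v' + var_mon l" using less_trans [OF w_u' [OF that] w(1)] unfolding v' by simp
      with v'_le_u' show False by simp
    qed
    ultimately show ?thesis by simp
  qed
  have u'_keys: "l < k" if "lkp u' k > 0" for k
  proof (rule keys_gt_mono [of "u' + var_mon i" w])
    show "u' + var_mon i \<le> w" using w_u' [OF i] by simp
    show "lkp (u' + var_mon i) k > 0" using that by (simp add: lookup_add)
  qed (use w_keys in auto)
  have l_last: "l < Max UNIV" by (rule less_le_trans [OF w_keys [OF i] le_last])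
  let ?y = "Poly_Mapping.single (Max UNIV :: 'n) (d - 1)"
  have "v = ?y + var_mon l"
  proof -
    \<comment> \<open>The product of this pair involves only \<open>x_1\<close>, \<open>x_l\<close>
      and \<open>x_n\<close>. As \<open>q \<le> u'\<close> has only variables after
      \<open>x_l\<close>, it must be the power of \<open>x_n\<close>; then \<open>x_a = x_n\<close>
      would put \<open>q x_a\<close> below \<open>v\<close>.\<close>
    let ?g = "?y + var_mon ?x" and ?h = "Poly_Mapping.single l d"
    have "?y \<le> u'" using single_last_le [of u'] deg' by simp
    then have "?g \<in> G"
      using first deg(4) u' less_if_first_less [of v ?g]
      by (simp add: G in_lexsegment lookup_add lookup_var_mon)
    moreover have "v \<le> ?h" using le_single [of v l] l_le deg by simp
    then have "?h \<in> H"
      using first less_imp_neq [OF l_first] less_if_first_less [of ?h u]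
      by (auto simp: H in_lexsegment lookup_single when_def)
    moreover have "mdvd ?g (?g + ?h)" "mdvd ?h (?g + ?h)"
      by (auto simp: mdvd_def lookup_add)
    ultimately obtain q a where q: "a \<noteq> ?x" "q \<le> u'" "v \<le> q + var_mon a" "mdeg q = d - 1"
        "mdvd (q + var_mon a) (?g + ?h)"
      using inter' by blast
    have q_keys: "l < k" if "lkp q k > 0" for k
      using keys_gt_mono [OF q(2) u'_keys that] .
    have qa: "k \<in> {?x, Max UNIV, l}" if "lkp (q + var_mon a) k > 0" for k
    proof -
      have "lkp (?g + ?h) k > 0"
        using q(5) that less_le_trans unfolding mdvd_def by blast
      then show ?thesis
        by (auto simp: lookup_add lookup_single lookup_var_mon when_def split: if_splits)
    qed
    have "q = ?y"
      unfolding q(4) [symmetric]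
    proof (rule eq_single_if_keys)
      fix k assume "lkp q k > 0"
      then show "k = Max UNIV"
        using qa [of k] q_keys [of k] l_first by (auto simp: lookup_add)
    qed
    have "a \<in> {Max UNIV, l}" using qa [of a] q(1) by (auto simp: lookup_add lookup_var_mon)
    moreover have "a \<noteq> Max UNIV"
    proof
      assume a: "a = Max UNIV"
      have "Max UNIV \<le> l"
      proof (rule keys_ge_mono [OF q(3) _ \<open>lkp v l > 0\<close>])
        show "Max UNIV \<le> k" if "lkp (q + var_mon a) k > 0" for k
          using that unfolding a \<open>q = ?y\<close>
          by (simp add: lookup_add lookup_single lookup_var_mon when_def split: if_splits)
      qed
      with l_last show False using leD by blast
    qed
    ultimately have "v \<le> ?y + var_mon l" using q(3) \<open>q = ?y\<close> by auto
    moreover have "?y + var_mon l \<le> v"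
      using single_last_le [of v'] deg' v' by simp
    ultimately show ?thesis by simp
  qed
  then show ?thesis using that l_first u' u'_keys by blast
qed

section \<open>Linear quotients of the remaining lexsegment ideals\<close>

text \<open>\<open>A\<close> may a priori contain other degrees. Each \<open>m\<close> in
  \<open>L\<close> has a divisor in \<open>A\<close>, which in turn has a divisor in
  \<open>L\<close>; the degrees force all three to agree, and minimality excludes further elements
  of \<open>A\<close>.\<close>

lemma minimal_monomial_generators_iff:
  assumes deg: "\<And>m. m \<in> L \<Longrightarrow> mdeg m = d"
  shows "minimal_monomial_generators (monomial_ideal L :: ('n::finite, 'k::field) mpol set) A
    \<longleftrightarrow> A = L"
proof
  assume min: "minimal_monomial_generators (monomial_ideal L :: ('n, 'k) mpol set) A"
  then have eq: "monomial_ideal A = (monomial_ideal L :: ('n, 'k) mpol set)"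
    by (simp add: minimal_monomial_generators_def)
  have div: "(\<exists>a\<in>A. mdvd a t) \<longleftrightarrow> (\<exists>m\<in>L. mdvd m t)" for t
    using mono_poly_in_monomial_ideal [of t A, where 'k = 'k]
      mono_poly_in_monomial_ideal [of t L, where 'k = 'k] eq by simp
  have "L \<subseteq> A"
  proof
    fix m assume m: "m \<in> L"
    then obtain a where a: "a \<in> A" "mdvd a m" using div mdvd_refl by blast
    then obtain m' where m': "m' \<in> L" "mdvd m' a" using div mdvd_refl by blast
    then have "m' = m"
      using a m deg mdvd_trans [of m' a m] mdvd_mdeg_eq by metis
    then have "mdeg a = mdeg m"
      using mdeg_mono a(2) m'(2) by (metis le_antisym)
    then show "m \<in> A" using a mdvd_mdeg_eq by metis
  qed
  then show "A = L"
    using min unfolding minimal_monomial_generators_def by blast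
next
  assume A: "A = L"
  have "monomial_ideal A' \<noteq> (monomial_ideal L :: ('n, 'k) mpol set)" if A': "A' \<subset> L" for A'
  proof
    assume eq: "monomial_ideal A' = (monomial_ideal L :: ('n, 'k) mpol set)"
    obtain m where m: "m \<in> L" "m \<notin> A'" using A' by blast
    then have "(mono_poly m :: ('n, 'k) mpol) \<in> monomial_ideal A'"
      unfolding eq mono_poly_in_monomial_ideal using mdvd_refl by blast
    then obtain a where "a \<in> A'" "mdvd a m" unfolding mono_poly_in_monomial_ideal by blast
    then show False using m A' deg mdvd_mdeg_eq by (metis psubsetD)
  qed
  with A show "minimal_monomial_generators (monomial_ideal L :: ('n, 'k) mpol set) A"
    by (simp add: minimal_monomial_generators_def)
qed

lemma finite_monomials: "finite (monomials d :: 'n::finite mon set)"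
proof -
  have "lkp t i \<le> mdeg t" for t :: "'n mon" and i
    unfolding mdeg_def by (rule member_le_sum) auto
  then have "lkp ` (monomials d :: 'n mon set) \<subseteq> (UNIV \<rightarrow>\<^sub>E {..d})"
    by (force simp: monomials_def)
  then have "finite (lkp ` (monomials d :: 'n mon set))"
    by (rule finite_subset) (simp add: finite_PiE)
  then show ?thesis
    by (rule finite_imageD) (simp add: inj_on_def poly_mapping_eqI)
qed

text \<open>Turns the prefixes in the definition of linear quotients into sets of predecessors, so
  that colon ideals can be computed without positions in a list.\<close>

lemma set_take_sorted_wrt:
  assumes "sorted_wrt R xs" "\<And>a b. R a b \<Longrightarrow> \<not> R b a" "j < length xs"
  shows "set (take j xs) = {a \<in> set xs. R a (xs ! j)}"
proof (intro equalityI subsetI CollectI conjI; (elim CollectE conjE)?)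
  fix a assume "a \<in> set (take j xs)"
  then obtain i where "i < j" "a = xs ! i" by (auto simp: in_set_conv_nth)
  then show "R a (xs ! j)" using assms sorted_wrt_nth_less by blast
next
  fix a assume "a \<in> set xs" "R a (xs ! j)"
  then obtain i where i: "i < length xs" "a = xs ! i" by (auto simp: in_set_conv_nth)
  have "i < j"
  proof (rule ccontr)
    assume "\<not> i < j"
    then consider "j < i" | "i = j" by linarith
    then show False
      using assms i \<open>R a (xs ! j)\<close> sorted_wrt_nth_less [OF assms(1), of j i] by cases blast+
  qed
  then show "a \<in> set (take j xs)" using i assms(3) by (auto simp: in_set_conv_nth)
qed (auto dest: in_set_takeD)

text \<open>The first difference is the witness. At or after \<open>b\<close> it would leave
  \<open>m\<close> without later variables, hence a divisor of \<open>s\<close> of the same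
  degree.\<close>

lemma larger_exceeds_before_max_key:
  fixes s m :: "'n::{finite,linorder} mon"
  assumes "m < s" "mdeg m = mdeg s" "lkp m (Min UNIV) = lkp s (Min UNIV)"
    and "\<And>k. lkp m k > 0 \<Longrightarrow> k \<le> b"
  obtains x where "Min UNIV < x" "x < b" "lkp m x < lkp s x"
proof -
  obtain k where k: "lkp m k < lkp s k" "\<And>j. j < k \<Longrightarrow> lkp m j = lkp s j"
    using assms(1) by (auto simp: less_mon_iff)
  have "k \<noteq> Min UNIV" using k(1) assms(3) by auto
  then have "Min UNIV < k" using first_le [of k] by (simp only: order_less_le) blast
  moreover have "k < b"
  proof (rule ccontr)
    assume "\<not> k < b"
    then have b: "lkp m j = 0" if "k < j" for j
      using assms(4) [of j] that by (metis gr0I leD le_less_trans not_le)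
    have "mdvd m s"
      unfolding mdvd_def
    proof
      fix j show "lkp m j \<le> lkp s j"
        by (rule linorder_cases [of j k]) (use k b in auto)
    qed
    then have "m = s" using mdvd_mdeg_eq assms(2) by blast
    with assms(1) show False by simp
  qed
  ultimately show ?thesis using that k(1) by blast
qed

text \<open>At the first difference, which is not before \<open>c\<close>, \<open>s\<close> falls
  short of \<open>p\<close>. Equal degrees force a later exponent to make up for it.\<close>

lemma smaller_exceeds_after_min_key:
  fixes s p :: "'n::{finite,linorder} mon"
  assumes "s < p" "mdeg s = mdeg p" "\<And>k. lkp p k > 0 \<Longrightarrow> c \<le> k"
  obtains x where "c < x" "lkp p x < lkp s x"
proof -
  obtain k where k: "lkp s k < lkp p k" "\<And>j. j < k \<Longrightarrow> lkp s j = lkp p j"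
    using assms(1) by (auto simp: less_mon_iff)
  have "c \<le> k" using k(1) assms(3) [of k] by simp
  have "\<exists>x>c. lkp p x < lkp s x"
  proof (rule ccontr)
    assume no: "\<not> (\<exists>x>c. lkp p x < lkp s x)"
    have "mdvd s p"
      unfolding mdvd_def
    proof
      fix j show "lkp s j \<le> lkp p j"
      proof (cases "c < j")
        case True
        then show ?thesis using no by (meson not_le)
      next
        case False
        then have "j \<le> k" using \<open>c \<le> k\<close> by simp
        then show ?thesis using k by (cases "j = k") auto
      qed
    qed
    then have "s = p" using mdvd_mdeg_eq assms(2) by blast
    with assms(1) show False by simp
  qed
  then show ?thesis using that by blast
qed

text \<open>Read as: \<open>s\<close> is listed before \<open>t\<close>. Exchanging one variable
  must lead to an earlier monomial inside the segment, so it goes up where \<open>u\<close> imposes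
  nothing and down where \<open>v\<close> imposes nothing.\<close>

definition quot_order :: "'n::{finite,linorder} mon \<Rightarrow> 'n mon \<Rightarrow> bool" where
  "quot_order s t \<longleftrightarrow>
     (if lkp t (Min UNIV) = 0 then lkp s (Min UNIV) = 0 \<and> t < s
      else lkp s (Min UNIV) = 0 \<or> s < t)"

lemma quot_order_asym: "quot_order s t \<Longrightarrow> \<not> quot_order t s"
  by (auto simp: quot_order_def split: if_splits)

lemma quot_order_list:
  fixes L :: "'n::{finite,linorder} mon set"
  assumes "finite L"
  obtains us where "distinct us" "set us = L" "sorted_wrt quot_order us"
proof -
  let ?H = "{m \<in> L. lkp m (Min UNIV) = 0}" and ?G = "{m \<in> L. lkp m (Min UNIV) \<noteq> 0}"
  let ?hs = "rev (sorted_list_of_set ?H)" and ?gs = "sorted_list_of_set ?G"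
  have fin: "finite ?H" "finite ?G" using assms by auto
  have "sorted_wrt quot_order ?hs"
    unfolding sorted_wrt_rev
  proof (rule sorted_wrt_mono_rel [of _ "(<)"])
    show "quot_order b a" if "a \<in> set (sorted_list_of_set ?H)" "b \<in> set (sorted_list_of_set ?H)" "a < b"
      for a b
      using that fin by (simp add: quot_order_def)
  qed simp
  moreover have "sorted_wrt quot_order ?gs"
  proof (rule sorted_wrt_mono_rel [of _ "(<)"])
    show "quot_order a b" if "a \<in> set ?gs" "b \<in> set ?gs" "a < b" for a b
      using that fin by (simp add: quot_order_def)
  qed simp
  moreover have "quot_order a b" if "a \<in> ?H" "b \<in> ?G" for a b
    using that by (simp add: quot_order_def)
  ultimately have "sorted_wrt quot_order (?hs @ ?gs)"
    using fin by (simp add: sorted_wrt_append)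
  moreover have "distinct (?hs @ ?gs)" "set (?hs @ ?gs) = L"
    using fin by auto
  ultimately show ?thesis using that by blast
qed

lemma ex_max_key:
  fixes m :: "'n::{finite,linorder} mon"
  assumes "mdeg m \<noteq> 0"
  obtains b where "lkp m b > 0" "\<And>k. lkp m k > 0 \<Longrightarrow> k \<le> b"
proof -
  obtain k where "lkp m k > 0" using assms by (rule mdeg_pos_key)
  then have "Max {k. lkp m k > 0} \<in> {k. lkp m k > 0}" by (intro Max_in) auto
  then show ?thesis using that [of "Max {k. lkp m k > 0}"] by (simp add: Max_ge)
qed

lemma ex_min_key:
  fixes m :: "'n::{finite,linorder} mon"
  assumes "mdeg m \<noteq> 0"
  obtains b where "lkp m b > 0" "\<And>k. lkp m k > 0 \<Longrightarrow> b \<le> k"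
proof -
  obtain k where "lkp m k > 0" using assms by (rule mdeg_pos_key)
  then have "Min {k. lkp m k > 0} \<in> {k. lkp m k > 0}" by (intro Min_in) auto
  then show ?thesis using that [of "Min {k. lkp m k > 0}"] by (simp add: Min_le)
qed

theorem shape_imp_linear_quotients:
  fixes u v :: "'n::{finite,linorder} mon"
  assumes d: "d \<ge> 2" and deg: "mdeg u = d" and l: "Min UNIV < l"
    and u: "u = u' + var_mon (Min UNIV)" and u': "\<And>k. lkp u' k > 0 \<Longrightarrow> l < k"
    and v: "v = Poly_Mapping.single (Max UNIV) (d - 1) + var_mon l"
    and v_first: "lkp v (Min UNIV) = 0"
  shows "has_linear_quotients (monomial_ideal (lexsegment d u v) :: ('n, 'k::field) mpol set)"
proof -
  let ?x = "Min UNIV :: 'n"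
  let ?L = "lexsegment d u v"
  have l_ne: "l \<noteq> ?x" using l by auto
  have u_first: "lkp u ?x > 0" by (simp add: u lookup_add lookup_var_mon)
  have "finite ?L"
    using finite_monomials by (rule finite_subset [rotated]) (auto simp: lexsegment_def)
  then obtain us where us: "distinct us" "set us = ?L" "sorted_wrt quot_order us"
    by (rule quot_order_list)
  have colon: "\<exists>X. colon_ideal (monomial_ideal {s \<in> ?L. quot_order s m}) (mono_poly m)
      = (ideal_gen (var_poly ` X) :: ('n, 'k) mpol set)" if m: "m \<in> ?L" for m
  proof (cases "lkp m ?x = 0")
    case True
    have "mdeg m \<noteq> 0" using m d by (simp add: in_lexsegment del: mdeg_eq_0)
    then obtain b where b: "lkp m b > 0" "\<And>k. lkp m k > 0 \<Longrightarrow> k \<le> b"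
      by (rule ex_max_key) blast
    from b(1) obtain r where r: "m = r + var_mon b" by (rule key_addend)
    \<comment> \<open>The colon ideal is generated by the variables strictly between
      \<open>x_1\<close> and the last variable \<open>x_b\<close> of \<open>m\<close>: trading
      \<open>x_b\<close> for one of them gives a larger, hence earlier, monomial.\<close>
    show ?thesis
    proof (intro exI colon_monomial_ideal_eq_vars)
      fix s assume "s \<in> {s \<in> ?L. quot_order s m}"
      then have "m < s" "mdeg m = mdeg s" "lkp m ?x = lkp s ?x"
        using m True by (auto simp: quot_order_def in_lexsegment)
      then obtain x where "?x < x" "x < b" "lkp m x < lkp s x"
        using b(2) by (rule larger_exceeds_before_max_key)
      then show "\<exists>x\<in>{i. ?x < i \<and> i < b}. lkp m x < lkp s x" by blast
    next
      fix x assume x: "x \<in> {i. ?x < i \<and> i < b}"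
      then have x_ne: "x \<noteq> ?x" by auto
      have "lkp (r + var_mon x) ?x = 0"
        using True x_ne by (auto simp: r lookup_add lookup_var_mon)
      moreover have "r + var_mon x < u"
        using u_first calculation by (intro less_if_first_less) simp
      moreover have less: "m < r + var_mon x" using x by (simp add: r)
      have "v \<le> m" using m by (simp add: in_lexsegment)
      then have "v < r + var_mon x" using less by (rule le_less_trans)
      moreover have "mdeg (r + var_mon x) = d" using m by (simp add: r in_lexsegment)
      ultimately have "r + var_mon x \<in> {s \<in> ?L. quot_order s m}"
        using True less by (simp add: quot_order_def in_lexsegment less_imp_le)
      moreover have "mdvd (r + var_mon x) (m + var_mon x)"
        by (simp add: r mdvd_def lookup_add)
      ultimately show "\<exists>s\<in>{s \<in> ?L. quot_order s m}. mdvd s (m + var_mon x)" by blast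
    qed
  next
    case False
    then have "lkp m ?x > 0" by simp
    then obtain p where p: "m = p + var_mon ?x" by (rule key_addend)
    have "p \<le> u'" and deg_p: "mdeg p = d - 1"
      using m by (auto simp: p u in_lexsegment)
    then have p_keys: "l < k" if "lkp p k > 0" for k
      using keys_gt_mono u' that by blast
    \<comment> \<open>As \<open>d \<ge> 2\<close>, a variable is left after dividing
      \<open>m\<close> by \<open>x_1\<close>.\<close>
    have "mdeg p \<noteq> 0" using deg_p d by (simp del: mdeg_eq_0)
    then obtain c where c: "lkp p c > 0" "\<And>k. lkp p k > 0 \<Longrightarrow> c \<le> k"
      by (rule ex_min_key) blast
    from c(1) obtain r where r: "p = r + var_mon c" by (rule key_addend)
    have l_c: "l < c" using p_keys c(1) by simp
    have m_0: "lkp m k = 0" if "k \<le> l" "k \<noteq> ?x" for k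
    proof -
      have "lkp p k = 0" using p_keys [of k] that(1) by (meson gr0I leD)
      then show ?thesis using that(2) by (simp add: p lookup_add lookup_var_mon)
    qed
    \<comment> \<open>Two kinds of variables generate the colon ideal. Those after
      \<open>x_1\<close> up to \<open>x_l\<close> may replace \<open>x_1\<close>, leading to the
      monomials listed first; those after the first variable \<open>x_c\<close> of \<open>p\<close>
      may replace \<open>x_c\<close>.\<close>
    show ?thesis
    proof (intro exI colon_monomial_ideal_eq_vars)
      fix s assume s: "s \<in> {s \<in> ?L. quot_order s m}"
      show "\<exists>x\<in>{i. ?x < i \<and> (i \<le> l \<or> c < i)}. lkp m x < lkp s x"
      proof (cases "lkp s ?x = 0")
        case True
        have "\<exists>k. lkp s k > 0 \<and> k \<le> l"
        proof (rule ccontr)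
          assume "\<not> ?thesis"
          then have "\<And>k. lkp s k > 0 \<Longrightarrow> l < k" by (meson not_le)
          moreover have "v \<le> s" using s by (simp add: in_lexsegment)
          ultimately have "l < l"
            by (intro keys_gt_mono [of v s l l]) (auto simp: v lookup_add lookup_var_mon)
          then show False by simp
        qed
        then obtain k where k: "lkp s k > 0" "k \<le> l" by blast
        then have "k \<noteq> ?x" using True by auto
        then have "?x < k" using first_le [of k] by (simp only: order_less_le) blast
        then show ?thesis using k m_0 [of k] \<open>k \<noteq> ?x\<close> by auto
      next
        case s_first: False
        then have "lkp s ?x > 0" by simp
        then obtain q where q: "s = q + var_mon ?x" by (rule key_addend)
        have "q < p" "mdeg q = mdeg p"
          using s s_first False m by (auto simp: quot_order_def in_lexsegment p q)
        then obtain x where x: "c < x" "lkp p x < lkp q x"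
          using c(2) by (rule smaller_exceeds_after_min_key)
        then have "?x < x" using l l_c by (metis less_trans)
        then show ?thesis using x by (auto simp: p q lookup_add)
      qed
    next
      fix x assume x: "x \<in> {i. ?x < i \<and> (i \<le> l \<or> c < i)}"
      then have x_ne: "x \<noteq> ?x" by auto
      have p_first: "lkp p ?x = 0" using p_keys [of ?x] l by auto
      show "\<exists>s\<in>{s \<in> ?L. quot_order s m}. mdvd s (m + var_mon x)"
      proof (cases "x \<le> l")
        case True
        have "lkp (p + var_mon x) ?x = 0"
          using p_first x_ne by (simp add: lookup_add lookup_var_mon)
        \<comment> \<open>Here the shape of \<open>v\<close> enters: \<open>x_n^(d-1)\<close> is the
          least monomial of its degree, and \<open>x\<close> is at most \<open>l\<close>.\<close>
        moreover have "v \<le> p + var_mon x"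
          unfolding v using single_last_le [of p] deg_p True by (intro add_mono) simp_all
        ultimately have "p + var_mon x \<in> {s \<in> ?L. quot_order s m}"
          using False d deg_p u_first less_if_first_less [of "p + var_mon x" u]
          by (simp add: quot_order_def in_lexsegment less_imp_le)
        moreover have "mdvd (p + var_mon x) (m + var_mon x)"
          by (simp add: p mdvd_def lookup_add)
        ultimately show ?thesis by blast
      next
        case nle: False
        let ?s = "r + var_mon x + var_mon ?x"
        have "r + var_mon x < p" using nle x by (simp add: r)
        then have less: "?s < m" by (simp add: p)
        moreover have "m \<le> u" using m by (simp add: in_lexsegment)
        then have "?s < u" by (rule less_le_trans [OF less])
        moreover have "v < ?s"
          using v_first by (intro less_if_first_less) (simp add: lookup_add lookup_var_mon)
        moreover have "mdeg ?s = d" using deg_p d by (simp add: r)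
        ultimately have "?s \<in> {s \<in> ?L. quot_order s m}"
          using False by (simp add: quot_order_def in_lexsegment less_imp_le)
        moreover have "mdvd ?s (m + var_mon x)"
          by (simp add: p r mdvd_def lookup_add)
        ultimately show ?thesis by blast
      qed
    qed
  qed
  have "\<exists>X. colon_ideal (monomial_ideal (set (take j us))) (mono_poly (us ! j))
      = (ideal_gen (var_poly ` X) :: ('n, 'k) mpol set)" if "j < length us" for j
    using colon [of "us ! j"] that us
      set_take_sorted_wrt [of quot_order us j, OF us(3) quot_order_asym that] nth_mem [OF that] by simp
  moreover have "minimal_monomial_generators (monomial_ideal ?L :: ('n, 'k) mpol set) (set us)"
    unfolding us(2) by (subst minimal_monomial_generators_iff [of _ d]) (auto simp: in_lexsegment)
  ultimately show ?thesis
    unfolding has_linear_quotients_def using us(1) by blast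
qed

theorem theorem2p1:
  fixes u v :: "'n::{finite,linorder} mon"
    and d :: nat
    and I :: "('n, 'k::field) mpol set"
  assumes "d \<ge> 2"
    and "u \<in> monomials d" and "v \<in> monomials d"
    and "Poly_Mapping.lookup u (Min UNIV) > 0" and "Poly_Mapping.lookup v (Min UNIV) = 0"
    and "I = monomial_ideal (lexsegment d u v)"
    and "\<not> completely_lexsegment_ideal I"
  shows "has_linear_resolution d I \<longleftrightarrow> has_linear_quotients I"
proof
  let ?L = "lexsegment d u v"
  have deg: "mdeg u = d" "mdeg v = d" using assms by (simp_all add: monomials_def)
  assume res: "has_linear_resolution d I"
  define G where "G = {m \<in> ?L. lkp m (Min UNIV) > 0}"
  define H where "H = {m \<in> ?L. lkp m (Min UNIV) = 0}"
  have GH: "G \<union> H = ?L" "G \<inter> H = {}" by (auto simp: G_def H_def)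
  have inter: "\<exists>s\<in>G. \<exists>t\<in>H. \<exists>a b. s + var_mon a = t + var_mon b \<and> mdvd (s + var_mon a) z"
    if gh: "g \<in> G" "h \<in> H" "mdvd g z" "mdvd h z" for g h z
  proof -
    have res': "has_linear_resolution d (monomial_ideal (G \<union> H) :: ('n, 'k) mpol set)"
      using res unfolding assms(6) GH(1) .
    have "mdeg m = d" if "m \<in> G \<union> H" for m
      using that unfolding GH(1) by (simp add: in_lexsegment)
    from linear_resolution_imp_intersection_generated [OF res' GH(2) this gh(1,3,2,4)]
    show ?thesis by metis
  qed
  have "\<not> completely_lexsegment ?L"
    using assms(6,7) unfolding completely_lexsegment_ideal_def by blast
  then obtain w where w: "mdeg w = d" "w < v"
      "\<And>i. lkp w i > 0 \<Longrightarrow> u + var_mon i < w + var_mon (Min UNIV)"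
    using deg assms(4,5) by (rule not_completely_lexsegment_witness) blast
  show "has_linear_quotients I"
  proof (rule endpoints_shape [OF deg w(1) _ assms(4,5) w(2) _ G_def H_def])
    show "d > 0" using assms(1) by simp
    show "u + var_mon i < w + var_mon (Min UNIV)" if "lkp w i > 0" for i
      using that by (rule w(3))
    show "\<exists>s\<in>G. \<exists>t\<in>H. \<exists>a b. s + var_mon a = t + var_mon b \<and> mdvd (s + var_mon a) z"
      if "g \<in> G" "h \<in> H" "mdvd g z" "mdvd h z" for g h z
      using that by (rule inter)
  next
    fix l u'
    assume "Min UNIV < l" "u = u' + var_mon (Min UNIV)"
      "v = Poly_Mapping.single (Max UNIV) (d - 1) + var_mon l" "\<And>k. lkp u' k > 0 \<Longrightarrow> l < k"
    from shape_imp_linear_quotients [OF assms(1) deg(1) this(1,2) _ this(3) assms(5)] this(4)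
    show "has_linear_quotients I" unfolding assms(6) by blast
  qed
next
  assume "has_linear_quotients I"
  then obtain us where us: "minimal_monomial_generators I (set us)"
    "\<And>j. 1 \<le> j \<Longrightarrow> j < length us \<Longrightarrow>
      \<exists>X. colon_ideal (monomial_ideal (set (take j us))) (mono_poly (us ! j))
        = (ideal_gen (var_poly ` X) :: ('n, 'k) mpol set)"
    unfolding has_linear_quotients_def by blast
  have deg: "mdeg m = d" if "m \<in> lexsegment d u v" for m
    using that by (simp add: in_lexsegment)
  have "set us = lexsegment d u v"
    using us(1) minimal_monomial_generators_iff [OF deg] unfolding assms(6) by blast
  then show "has_linear_resolution d I"
    using linear_quotients_imp_linear_resolution [of us d, OF _ us(2)] deg unfolding assms(6) by metis
qed

end
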